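(* Let the data $C,U,g,\delta,\Delta,\phi,T$ satisfy the standing assumptions (H1)--(H5) of the context, let $(\overline x(\cdot),\overline u(\cdot))$ be a relaxed $W^{1,2}\times L^2$-local minimizer of the optimal control problem (DMP) of the context, and let $(\mathcal{P}_m)$, $m\in\mathbb{N}$, be the associated discrete-time problems of the context. Suppose in addition that the cost function $\varphi$ is lower semicontinuous on $\mathbb{R}^n$. Then for each problem $(\mathcal{P}_m)$ there exists an optimal solution provided that $m\in\mathbb{N}$ is sufficiently large.
   Context: **Problem (DMP).** Let $T>0$ and $C=\bigcap_{j=1}^s\{x\in\mathbb{R}^n\mid\langle x_*^j,x\rangle\le c_j\}$ with $\|x_*^j\|=1$. Minimize $J[x,u]=\varphi(x(T))$ subject to $$-\dot x(t)\in N_C(x(t))+g(t,x(t),x(t-\delta(t)),u(t))\ \text{a.e. } t\in[0,T],\quad x(s)=\phi(s),\ s\in[-\Delta,0],\quad u(t)\in U\ \text{a.e. } t\in[0,T].$$ Here $N_C(x):=\{v\mid\langle v,y-x\rangle\le0\ \forall y\in C\}$ if $x\in C$ and $N_C(x):=\emptyset$ otherwise. A feasible pair is $(x(\cdot),u(\cdot))$ with $u$ measurable and $x\in W^{1,2}([0,T],\mathbb{R}^n)$, satisfying all these constraints. **Standing assumptions.** (H1) $U\subset\mathbb{R}^d$ is nonempty and compact. (H2) $g:[0,T]\times\mathbb{R}^n\times\mathbb{R}^n\times\mathbb{R}^d\to\mathbb{R}^n$ is continuous, and Lipschitz continuous with respect to $(t,x,y)$ uniformly on $U$ whenever $(x,y)$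 belongs to a bounded set. (H3) There is $\beta>0$ with $\|g(t,x,y,u)\|\le\beta(1+\|x\|+\|y\|)$ for all $t\in[0,T]$ and $(x,y,u)\in\mathbb{R}^n\times\mathbb{R}^n\times U$. (H4) $\delta:[0,T]\to[0,\infty)$ is Lipschitz continuous, nonincreasing, with $0<\Delta:=\max_{[0,T]}\delta<\infty$. (H5) $\phi:[-\Delta,0]\to\mathbb{R}^n$ is Lipschitz continuous. **Relaxed local minimizer.** A feasible pair $(\overline x,\overline u)$ is a relaxed $W^{1,2}\times L^2$-local minimizer of (DMP) if there is $\epsilon>0$ such that $\varphi(\overline x(T))\le\varphi(x(T))$ whenever $\int_0^T(\|\dot x(t)-\dot{\overline x}(t)\|^2+\|u(t)-\overline u(t)\|^2)\,dt<\epsilon$, where $u(\cdot)$ is a measurable control with $u(t)\in\operatorname{co}U$ for a.e. $t\in[0,T]$, and $x(\cdot)$ is a trajectory of $\dot x(t)\in-N_C(x(t))+\operatorname{co}\,g(t,x(t),x(t-\delta(t)),U)$ (with $x=\phi$ on $[-\Delta,0]$) which can be uniformly approximated in the $W^{1,2}([0,T];\mathbb{R}^n)$-norm topology by feasible trajectories of (DMP) generated by piecewise constant controls $u^k(\cdot)$ on $[0,T]$ in such a way that their convex combinations converge strongly to $u(\cdot)$ in the norm topology of $L^2([0,T];\mathbb{R}^d)$. Fix this $\epsilon$. **Perturbation terms.** Put $h_m:=T/2^m$, $t_m^i:=ih_m$, and let $\mathbb{B}$ be the closed unit ball of $\mathbb{R}^n$. The functions $r_m:[0,T]\to[0,\infty)$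 and $\rho_m:[0,T]\to\mathbb{B}$ are those of a strong discrete approximation of $(\overline x,\overline u)$: they are constant on each $[t_m^{i-1},t_m^i)$, $r_m\to0$ in $L^2(0,T)$, and there are $\hat u_m:[0,T]\to U$ constant on each $[t_m^{i-1},t_m^i)$ with $\hat u_m\to\overline u$ strongly in $L^2([0,T],\mathbb{R}^d)$ and pointwise, and continuous $\hat x_m:[0,T]\to\mathbb{R}^n$, affine on each $[t_m^{i-1},t_m^i)$, extended by $\phi$ to $[-\Delta,0]$, with $\hat x_m\to\overline x$ strongly in $W^{1,2}([0,T],\mathbb{R}^n)$, $\hat x_m(t_m^i)=\overline x(t_m^i)\in C$ for $i=1,\dots,2^m$, $\hat x_m(0)=\phi(0)=x_0$, each $\hat x_m$ Lipschitz on $[0,T]$ with the same constant as $\overline x$, and $$\dot{\hat x}_m(t)\in-N_C(\hat x_m(t_m^i))+g(t_m^i,\hat x_m(t_m^i),\hat x_m(t_m^i-\delta(t_m^i)),\hat u_m(t))+r_m(t)\rho_m(t),\quad t\in(t_m^{i-1},t_m^i),\ i=1,\dots,2^m.$$ **Discrete problems $(\mathcal{P}_m)$.** Let $L$ be a Lipschitz constant of $\overline x$ on $[0,T]$. The decision variables are $(x_m^0,\dots,x_m^{2^m},u_m^0,\dots,u_m^{2^m-1})$. Let $x_m(\cdot)$ equal $\phi$ on $[-\Delta,0]$ and the piecewise linear interpolation of the $x_m^i$ at the nodes $t_m^i$ on $[0,T]$, and set $y_m^i:=x_m(t_m^i-\delta(t_m^i))$. With $\overline x=\phi$ on $[-\Delta,0]$,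 put $$E_m:=\sum_{i=0}^{2^m-1}\int_{t_m^i}^{t_m^{i+1}}\Big(\Big\|\tfrac{x_m^{i+1}-x_m^i}{h_m}-\dot{\overline x}(t)\Big\|^2+\Big\|\tfrac{y_m^{i+1}-y_m^i}{h_m}-\dot{\overline x}(t-\delta(t))\Big\|^2+\|u_m^i-\overline u(t)\|^2\Big)dt.$$ Problem $(\mathcal{P}_m)$: minimize $J_m[x_m,u_m]:=\varphi(x_m^{2^m})+E_m$ subject to - $x_m^{i+1}-x_m^i\in -h_m\big(N_C(x_m^i)-g(t_m^i,x_m^i,y_m^i,u_m^i)-r_m(t_m^i)\rho_m(t_m^i)\big)$, $i=0,\dots,2^m-1$; - $\langle x_*^j,x_m^{2^m}\rangle\le c_j$, $j=1,\dots,s$; - $x_m^0=\phi(0)=x_0\in C$; - $\|(x_m^{i+1}-x_m^i)/h_m\|\le L$, $i=0,\dots,2^m-1$; - $\|x_m^i-\overline x(t_m^i)\|\le\epsilon/2$ and $\|y_m^i-\overline x(t_m^i-\delta(t_m^i))\|\le\epsilon/2$, $i=0,\dots,2^m-1$; - $u_m^i\in U$, $i=0,\dots,2^m-1$; - $E_m\le\epsilon/2$.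
   Formalization: As printed, (P_m) can be infeasible for all m. Corrected: +g in all inclusions, also in (DMP); the inclusion for x̂_m at node t_m^i holds on (t_m^i, t_m^{i+1}), i=0,…,2^m−1, not on the cell to its left; E_m uses the derivative of t↦x̄(t−δ(t)) in place of x̄'(t−δ(t)). *)

theory Defs
  imports "HOL-Analysis.Analysis"
begin

text \<open>
  Conventions. Trajectories and controls are total functions on \<open>real\<close>; a trajectory is only looked
  at on \<open>[-\<Delta>, T]\<close>, a control only on \<open>[0, T]\<close>. \<open>cost\<close> is the cost function \<open>\<phi>\<close> on the state space and
  \<open>hist\<close> is the initial history on \<open>[-\<Delta>, 0]\<close>. The source writes the state equation once as
  \<open>-x' \<in> N\<^sub>C(x) + g\<close> and everywhere else (relaxation, approximation, discrete problems) as
  \<open>x' \<in> -N\<^sub>C(x) + g\<close>; the second form is used throughout, since the discrete and relaxed problems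
  belong to the original one only if the sign of \<open>g\<close> is the same in all of them.
\<close>

definition polyhedral_set :: "(nat \<Rightarrow> 'a::euclidean_space) \<Rightarrow> (nat \<Rightarrow> real) \<Rightarrow> nat \<Rightarrow> 'a set" where
  "polyhedral_set xstar c s = (\<Inter>j\<in>{1..s}. {x. xstar j \<bullet> x \<le> c j})"

definition normal_cone :: "'a::euclidean_space set \<Rightarrow> 'a \<Rightarrow> 'a set" where
  "normal_cone C x = (if x \<in> C then {v. \<forall>y\<in>C. v \<bullet> (y - x) \<le> 0} else {})"

definition lower_semicontinuous :: "('a::topological_space \<Rightarrow> real) \<Rightarrow> bool" where
  "lower_semicontinuous f \<longleftrightarrow> (\<forall>x a. a < f x \<longrightarrow> (\<forall>\<^sub>F y in nhds x. a < f y))"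

subsection \<open>The spaces \<open>L\<^sup>2\<close> and \<open>W\<^sup>1\<^sup>,\<^sup>2\<close> on \<open>[0, T]\<close>\<close>

definition L2_on :: "real \<Rightarrow> (real \<Rightarrow> 'a::euclidean_space) \<Rightarrow> bool" where
  "L2_on T f \<longleftrightarrow> f \<in> borel_measurable (lebesgue_on {0..T}) \<and>
     integrable (lebesgue_on {0..T}) (\<lambda>t. (norm (f t))\<^sup>2)"

text \<open>Membership in \<open>L2_on\<close> is required explicitly because the integral of a non-integrable function
  is \<open>0\<close>.\<close>

definition L2_tendsto ::
  "real \<Rightarrow> (nat \<Rightarrow> real \<Rightarrow> 'a::euclidean_space) \<Rightarrow> (real \<Rightarrow> 'a) \<Rightarrow> bool" where
  "L2_tendsto T fs f \<longleftrightarrow> (\<forall>k. L2_on T (fs k)) \<and> L2_on T f \<and>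
     (\<lambda>k. LINT t|lebesgue_on {0..T}. (norm (fs k t - f t))\<^sup>2) \<longlonglongrightarrow> 0"

text \<open>\<open>has_W12_deriv T x v\<close>: \<open>x\<close> belongs to \<open>W\<^sup>1\<^sup>,\<^sup>2\<close> on \<open>[0, T]\<close> (it is the indefinite integral of
  a square integrable function) and \<open>v\<close> is a representative of the almost everywhere defined
  derivative of \<open>x\<close>. The representative is unique up to null sets.\<close>

definition has_W12_deriv ::
  "real \<Rightarrow> (real \<Rightarrow> 'a::euclidean_space) \<Rightarrow> (real \<Rightarrow> 'a) \<Rightarrow> bool" where
  "has_W12_deriv T x v \<longleftrightarrow> L2_on T v \<and>
     (\<forall>t\<in>{0..T}. x t = x 0 + (LINT s|lebesgue_on {0..t}. v s))"

definition W12_tendsto ::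
  "real \<Rightarrow> (nat \<Rightarrow> real \<Rightarrow> 'a::euclidean_space) \<Rightarrow> (real \<Rightarrow> 'a) \<Rightarrow> bool" where
  "W12_tendsto T xs x \<longleftrightarrow> (\<exists>vs v. (\<forall>k. has_W12_deriv T (xs k) (vs k)) \<and> has_W12_deriv T x v \<and>
     L2_tendsto T xs x \<and> L2_tendsto T vs v)"

subsection \<open>The problem (DMP) and its relaxed local minimizers\<close>

definition DMP_feasible ::
  "real \<Rightarrow> 'a::euclidean_space set \<Rightarrow> 'b::euclidean_space set \<Rightarrow> (real \<Rightarrow> 'a \<Rightarrow> 'a \<Rightarrow> 'b \<Rightarrow> 'a) \<Rightarrow>
   (real \<Rightarrow> real) \<Rightarrow> real \<Rightarrow> (real \<Rightarrow> 'a) \<Rightarrow> (real \<Rightarrow> 'a) \<Rightarrow> (real \<Rightarrow> 'b) \<Rightarrow> bool" where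
  "DMP_feasible T C U g \<delta> \<Delta> hist x u \<longleftrightarrow>
     u \<in> borel_measurable (lebesgue_on {0..T}) \<and>
     (AE t in lebesgue_on {0..T}. u t \<in> U) \<and>
     (\<forall>s\<in>{-\<Delta>..0}. x s = hist s) \<and>
     (\<exists>v. has_W12_deriv T x v \<and>
        (AE t in lebesgue_on {0..T}.
           v t \<in> {g t (x t) (x (t - \<delta> t)) (u t) - w | w. w \<in> normal_cone C (x t)}))"

definition piecewise_constant_on :: "real \<Rightarrow> (real \<Rightarrow> 'b) \<Rightarrow> bool" where
  "piecewise_constant_on T u \<longleftrightarrow> (\<exists>(p::nat) \<tau>. \<tau> 0 = 0 \<and> \<tau> p = T \<and>
     (\<forall>i<p. \<tau> i < \<tau> (Suc i) \<and> (\<exists>b. \<forall>t\<in>{\<tau> i..<\<tau> (Suc i)}. u t = b)))"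

text \<open>A pair \<open>(x, u)\<close> that competes with a relaxed local minimizer. As in Mazur's theorem, the
  \<open>k\<close>-th convex combination is formed from finitely many of the controls \<open>us j\<close> with \<open>j \<ge> k\<close>.\<close>

definition relaxed_competitor ::
  "real \<Rightarrow> 'a::euclidean_space set \<Rightarrow> 'b::euclidean_space set \<Rightarrow> (real \<Rightarrow> 'a \<Rightarrow> 'a \<Rightarrow> 'b \<Rightarrow> 'a) \<Rightarrow>
   (real \<Rightarrow> real) \<Rightarrow> real \<Rightarrow> (real \<Rightarrow> 'a) \<Rightarrow> (real \<Rightarrow> 'a) \<Rightarrow> (real \<Rightarrow> 'b) \<Rightarrow> bool" where
  "relaxed_competitor T C U g \<delta> \<Delta> hist x u \<longleftrightarrow>
     u \<in> borel_measurable (lebesgue_on {0..T}) \<and>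
     (AE t in lebesgue_on {0..T}. u t \<in> convex hull U) \<and>
     (\<forall>s\<in>{-\<Delta>..0}. x s = hist s) \<and>
     (\<exists>v. has_W12_deriv T x v \<and>
        (AE t in lebesgue_on {0..T}.
           v t \<in> {q - w | q w. q \<in> convex hull (g t (x t) (x (t - \<delta> t)) ` U) \<and>
                              w \<in> normal_cone C (x t)})) \<and>
     (\<exists>xs us. (\<forall>k. DMP_feasible T C U g \<delta> \<Delta> hist (xs k) (us k) \<and> piecewise_constant_on T (us k)) \<and>
        W12_tendsto T xs x \<and>
        (\<exists>(N::nat \<Rightarrow> nat) (lam::nat \<Rightarrow> nat \<Rightarrow> real).
           (\<forall>k. k \<le> N k \<and> (\<forall>j\<in>{k..N k}. 0 \<le> lam k j) \<and> (\<Sum>j=k..N k. lam k j) = 1) \<and>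
           L2_tendsto T (\<lambda>k t. \<Sum>j=k..N k. lam k j *\<^sub>R us j t) u))"

text \<open>The relaxed \<open>W\<^sup>1\<^sup>,\<^sup>2 \<times> L\<^sup>2\<close>-local minimizers for a given radius \<open>\<epsilon>\<close>, which enters the discrete
  problems.\<close>

definition relaxed_local_minimizer ::
  "real \<Rightarrow> 'a::euclidean_space set \<Rightarrow> 'b::euclidean_space set \<Rightarrow> (real \<Rightarrow> 'a \<Rightarrow> 'a \<Rightarrow> 'b \<Rightarrow> 'a) \<Rightarrow>
   (real \<Rightarrow> real) \<Rightarrow> real \<Rightarrow> (real \<Rightarrow> 'a) \<Rightarrow> ('a \<Rightarrow> real) \<Rightarrow> real \<Rightarrow> (real \<Rightarrow> 'a) \<Rightarrow> (real \<Rightarrow> 'b) \<Rightarrow> bool" where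
  "relaxed_local_minimizer T C U g \<delta> \<Delta> hist cost \<epsilon> xbar ubar \<longleftrightarrow>
     0 < \<epsilon> \<and> DMP_feasible T C U g \<delta> \<Delta> hist xbar ubar \<and>
     (\<forall>x u v vbar. relaxed_competitor T C U g \<delta> \<Delta> hist x u \<longrightarrow>
        has_W12_deriv T x v \<longrightarrow> has_W12_deriv T xbar vbar \<longrightarrow>
        (LINT t|lebesgue_on {0..T}. (norm (v t - vbar t))\<^sup>2 + (norm (u t - ubar t))\<^sup>2) < \<epsilon> \<longrightarrow>
        cost (xbar T) \<le> cost (x T))"

subsection \<open>Strong discrete approximations\<close>

definition mesh :: "real \<Rightarrow> nat \<Rightarrow> real" where
  "mesh T m = T / 2 ^ m"

definition node :: "real \<Rightarrow> nat \<Rightarrow> nat \<Rightarrow> real" where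
  "node T m i = real i * mesh T m"

definition cellwise_constant :: "real \<Rightarrow> nat \<Rightarrow> (real \<Rightarrow> 'b) \<Rightarrow> bool" where
  "cellwise_constant T m f \<longleftrightarrow>
     (\<forall>i<2 ^ m. \<exists>b. \<forall>t\<in>{node T m i..<node T m (Suc i)}. f t = b)"

definition cellwise_affine :: "real \<Rightarrow> nat \<Rightarrow> (real \<Rightarrow> 'a::real_vector) \<Rightarrow> bool" where
  "cellwise_affine T m f \<longleftrightarrow>
     (\<forall>i<2 ^ m. \<exists>a b. \<forall>t\<in>{node T m i..<node T m (Suc i)}. f t = a + t *\<^sub>R b)"

text \<open>The cell attached to the node \<open>node T m i\<close> is the one to its right, as in the discrete
  problems below, where \<open>u i\<close>, \<open>r m (node T m i)\<close> and \<open>\<rho> m (node T m i)\<close> are the values on that cell.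
  (In the source the inclusion for \<open>xhat m\<close> pairs the node with the cell to its left. With that
  pairing a perturbation \<open>r, \<rho>\<close> fits an implicit scheme, is inserted into the explicit scheme of the
  discrete problems, and these can be infeasible for every \<open>m\<close>.)\<close>

definition strong_discrete_approx ::
  "real \<Rightarrow> 'a::euclidean_space set \<Rightarrow> 'b::euclidean_space set \<Rightarrow> (real \<Rightarrow> 'a \<Rightarrow> 'a \<Rightarrow> 'b \<Rightarrow> 'a) \<Rightarrow>
   (real \<Rightarrow> real) \<Rightarrow> real \<Rightarrow> (real \<Rightarrow> 'a) \<Rightarrow> (real \<Rightarrow> 'a) \<Rightarrow> (real \<Rightarrow> 'b) \<Rightarrow>
   (nat \<Rightarrow> real \<Rightarrow> 'a) \<Rightarrow> (nat \<Rightarrow> real \<Rightarrow> 'b) \<Rightarrow> (nat \<Rightarrow> real \<Rightarrow> real) \<Rightarrow> (nat \<Rightarrow> real \<Rightarrow> 'a) \<Rightarrow> bool" where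
  "strong_discrete_approx T C U g \<delta> \<Delta> hist xbar ubar xhat uhat r \<rho> \<longleftrightarrow>
     (\<forall>m. \<forall>t\<in>{0..T}. 0 \<le> r m t \<and> norm (\<rho> m t) \<le> 1 \<and> uhat m t \<in> U) \<and>
     (\<forall>m. cellwise_constant T m (r m) \<and> cellwise_constant T m (\<rho> m) \<and>
          cellwise_constant T m (uhat m)) \<and>
     L2_tendsto T r (\<lambda>t. 0) \<and>
     L2_tendsto T uhat ubar \<and> (\<forall>t\<in>{0..T}. (\<lambda>m. uhat m t) \<longlonglongrightarrow> ubar t) \<and>
     (\<forall>m. continuous_on {0..T} (xhat m) \<and> cellwise_affine T m (xhat m) \<and>
          (\<forall>s\<in>{-\<Delta>..0}. xhat m s = hist s)) \<and>
     W12_tendsto T xhat xbar \<and>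
     (\<forall>m. \<forall>i\<in>{1..2 ^ m}. xhat m (node T m i) = xbar (node T m i) \<and> xbar (node T m i) \<in> C) \<and>
     (\<forall>m. xhat m 0 = hist 0) \<and>
     (\<forall>K m. K-lipschitz_on {0..T} xbar \<longrightarrow> K-lipschitz_on {0..T} (xhat m)) \<and>
     (\<forall>m. \<forall>i<2 ^ m. \<forall>t\<in>{node T m i<..<node T m (Suc i)}.
        vector_derivative (xhat m) (at t) \<in>
          {g (node T m i) (xhat m (node T m i)) (xhat m (node T m i - \<delta> (node T m i))) (uhat m t)
             + r m t *\<^sub>R \<rho> m t - w | w. w \<in> normal_cone C (xhat m (node T m i))})"

subsection \<open>The discrete problems\<close>

text \<open>The decision variables are sequences \<open>x\<close>, \<open>u\<close>, of which only \<open>x 0, \<dots>, x (2 ^ m)\<close> and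
  \<open>u 0, \<dots>, u (2 ^ m - 1)\<close> matter. At \<open>t = T\<close> the coefficient of \<open>x (2 ^ m + 1)\<close> in
  \<open>interpolant\<close> vanishes.\<close>

definition interpolant :: "real \<Rightarrow> (real \<Rightarrow> 'a::real_vector) \<Rightarrow> nat \<Rightarrow> (nat \<Rightarrow> 'a) \<Rightarrow> real \<Rightarrow> 'a" where
  "interpolant T hist m x t =
     (if t \<le> 0 then hist t
      else let i = nat \<lfloor>t / mesh T m\<rfloor>
           in x i + ((t - node T m i) / mesh T m) *\<^sub>R (x (Suc i) - x i))"

definition delayed_state ::
  "real \<Rightarrow> (real \<Rightarrow> real) \<Rightarrow> (real \<Rightarrow> 'a::real_vector) \<Rightarrow> nat \<Rightarrow> (nat \<Rightarrow> 'a) \<Rightarrow> nat \<Rightarrow> 'a" where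
  "delayed_state T \<delta> hist m x i = interpolant T hist m x (node T m i - \<delta> (node T m i))"

text \<open>The penalty term \<open>E\<^sub>m\<close>. Here \<open>dxbar\<close> is the derivative of \<open>xbar\<close> and \<open>dybar\<close> that of the delayed
  trajectory \<open>t \<mapsto> xbar (t - \<delta> t)\<close>, the limit of the difference quotients of \<open>y\<close>. It differs from
  \<open>dxbar (t - \<delta> t)\<close> by the factor \<open>1 - \<delta>' t\<close>; with the latter in its place the penalty would in
  general not tend to \<open>0\<close> along the approximations of \<open>xbar\<close> unless \<open>\<delta>\<close> is constant.\<close>

definition penalty ::
  "real \<Rightarrow> (real \<Rightarrow> real) \<Rightarrow> (real \<Rightarrow> 'a::euclidean_space) \<Rightarrow> (real \<Rightarrow> 'a) \<Rightarrow> (real \<Rightarrow> 'a) \<Rightarrow>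
   (real \<Rightarrow> 'b::euclidean_space) \<Rightarrow> nat \<Rightarrow> (nat \<Rightarrow> 'a) \<Rightarrow> (nat \<Rightarrow> 'b) \<Rightarrow> real" where
  "penalty T \<delta> hist dxbar dybar ubar m x u =
     (let y = delayed_state T \<delta> hist m x in
      \<Sum>i<2 ^ m. LINT t|lebesgue_on {node T m i..node T m (Suc i)}.
        (norm ((x (Suc i) - x i) /\<^sub>R mesh T m - dxbar t))\<^sup>2
      + (norm ((y (Suc i) - y i) /\<^sub>R mesh T m - dybar t))\<^sup>2
      + (norm (u i - ubar t))\<^sup>2)"

definition discrete_feasible ::
  "real \<Rightarrow> 'a::euclidean_space set \<Rightarrow> 'b::euclidean_space set \<Rightarrow> (real \<Rightarrow> 'a \<Rightarrow> 'a \<Rightarrow> 'b \<Rightarrow> 'a) \<Rightarrow>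
   (real \<Rightarrow> real) \<Rightarrow> (real \<Rightarrow> 'a) \<Rightarrow> real \<Rightarrow> real \<Rightarrow>
   (real \<Rightarrow> 'a) \<Rightarrow> (real \<Rightarrow> 'a) \<Rightarrow> (real \<Rightarrow> 'a) \<Rightarrow> (real \<Rightarrow> 'b) \<Rightarrow>
   (nat \<Rightarrow> real \<Rightarrow> real) \<Rightarrow> (nat \<Rightarrow> real \<Rightarrow> 'a) \<Rightarrow> nat \<Rightarrow> (nat \<Rightarrow> 'a) \<Rightarrow> (nat \<Rightarrow> 'b) \<Rightarrow> bool" where
  "discrete_feasible T C U g \<delta> hist L \<epsilon> xbar dxbar dybar ubar r \<rho> m x u \<longleftrightarrow>
     (let y = delayed_state T \<delta> hist m x; t = node T m in
      (\<forall>i<2 ^ m. x (Suc i) - x i \<in>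
         {- mesh T m *\<^sub>R (w - g (t i) (x i) (y i) (u i) - r m (t i) *\<^sub>R \<rho> m (t i)) | w.
            w \<in> normal_cone C (x i)}) \<and>
      x (2 ^ m) \<in> C \<and>
      x 0 = hist 0 \<and> hist 0 \<in> C \<and>
      (\<forall>i<2 ^ m. norm ((x (Suc i) - x i) /\<^sub>R mesh T m) \<le> L) \<and>
      (\<forall>i<2 ^ m. norm (x i - xbar (t i)) \<le> \<epsilon> / 2 \<and>
                 norm (y i - xbar (t i - \<delta> (t i))) \<le> \<epsilon> / 2) \<and>
      (\<forall>i<2 ^ m. u i \<in> U) \<and>
      penalty T \<delta> hist dxbar dybar ubar m x u \<le> \<epsilon> / 2)"

definition discrete_cost ::
  "real \<Rightarrow> (real \<Rightarrow> real) \<Rightarrow> (real \<Rightarrow> 'a::euclidean_space) \<Rightarrow> ('a \<Rightarrow> real) \<Rightarrow> (real \<Rightarrow> 'a) \<Rightarrow>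
   (real \<Rightarrow> 'a) \<Rightarrow> (real \<Rightarrow> 'b::euclidean_space) \<Rightarrow> nat \<Rightarrow> (nat \<Rightarrow> 'a) \<Rightarrow> (nat \<Rightarrow> 'b) \<Rightarrow> real" where
  "discrete_cost T \<delta> hist cost dxbar dybar ubar m x u =
     cost (x (2 ^ m)) + penalty T \<delta> hist dxbar dybar ubar m x u"

definition discrete_optimal ::
  "real \<Rightarrow> 'a::euclidean_space set \<Rightarrow> 'b::euclidean_space set \<Rightarrow> (real \<Rightarrow> 'a \<Rightarrow> 'a \<Rightarrow> 'b \<Rightarrow> 'a) \<Rightarrow>
   (real \<Rightarrow> real) \<Rightarrow> (real \<Rightarrow> 'a) \<Rightarrow> ('a \<Rightarrow> real) \<Rightarrow> real \<Rightarrow> real \<Rightarrow>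
   (real \<Rightarrow> 'a) \<Rightarrow> (real \<Rightarrow> 'a) \<Rightarrow> (real \<Rightarrow> 'a) \<Rightarrow> (real \<Rightarrow> 'b) \<Rightarrow>
   (nat \<Rightarrow> real \<Rightarrow> real) \<Rightarrow> (nat \<Rightarrow> real \<Rightarrow> 'a) \<Rightarrow> nat \<Rightarrow> (nat \<Rightarrow> 'a) \<Rightarrow> (nat \<Rightarrow> 'b) \<Rightarrow> bool" where
  "discrete_optimal T C U g \<delta> hist cost L \<epsilon> xbar dxbar dybar ubar r \<rho> m x u \<longleftrightarrow>
     discrete_feasible T C U g \<delta> hist L \<epsilon> xbar dxbar dybar ubar r \<rho> m x u \<and>
     (\<forall>x' u'. discrete_feasible T C U g \<delta> hist L \<epsilon> xbar dxbar dybar ubar r \<rho> m x' u' \<longrightarrow>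
        discrete_cost T \<delta> hist cost dxbar dybar ubar m x u
          \<le> discrete_cost T \<delta> hist cost dxbar dybar ubar m x' u')"

end

theory Submission
  imports Defs
begin

text \<open>
  The problem \<open>P\<^sub>m\<close> is finite dimensional, its feasible set is compact and its cost is lower
  semicontinuous, so an optimal solution exists as soon as the feasible set is nonempty. For large
  \<open>m\<close> the nodal values of \<open>xhat m\<close>, which are those of \<open>xbar\<close>, together with the values of
  \<open>uhat m\<close>, are feasible. Only the two constraints with \<open>\<epsilon>\<close> are in doubt. The bound on the
  states holds because \<open>xhat m\<close> and \<open>xbar\<close> share a Lipschitz constant and agree at the nodes.
  The bound on the penalty holds because difference quotients of a \<open>W\<^sup>1\<^sup>,\<^sup>2\<close> function are the cell
  means of its derivative, which converge to it in \<open>L\<^sup>2\<close>.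
\<close>

subsection \<open>Square integrable functions on an interval\<close>

text \<open>The integral of \<open>(norm (c - f t))\<^sup>2\<close> over a cell is an explicit
  quadratic polynomial in \<open>c\<close>, and this carries most of the analysis. Its coefficients
  do not involve the decision variables, so the penalty depends continuously on them. Completing the
  square around the mean splits the error of any constant exactly into the error of the mean and the
  cell length times a squared deviation. The delayed difference quotients are the obstacle. The
  candidate trajectory agrees with \<open>xbar\<close> at the nodes, but delayed nodes may lie
  anywhere inside a cell or in the history. The uniform bound of order \<open>mesh T m\<close> on
  \<open>xhat m - xbar\<close> is too weak there: its increments enter squared and divided by the
  mesh, over \<open>2 ^ m\<close> cells, which gives only a bounded sum. Convergence of the
  derivatives of \<open>xhat m\<close> in L2 makes this sum vanish. The normal cone constraint is
  closed because, tested against one fixed point of \<open>C\<close>, it is a single inequality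
  between continuous functions of the decision variables.\<close>

definition L2_between :: "real \<Rightarrow> real \<Rightarrow> (real \<Rightarrow> 'a::euclidean_space) \<Rightarrow> bool" where
  "L2_between a b f \<longleftrightarrow> f \<in> borel_measurable (lebesgue_on {a..b}) \<and>
     integrable (lebesgue_on {a..b}) (\<lambda>t. (norm (f t))\<^sup>2)"

lemma L2_on_iff_L2_between: "L2_on T f \<longleftrightarrow> L2_between 0 T f"
  by (simp add: L2_on_def L2_between_def)

lemma L2_between_subinterval:
  assumes "L2_between a b f" "a \<le> c" "d \<le> b"
  shows "L2_between c d f"
proof -
  have sub: "{c..d} \<subseteq> {a..b}" using assms by auto
  have f: "f \<in> borel_measurable (lebesgue_on {a..b})"
    and i: "integrable (lebesgue_on {a..b}) (\<lambda>t. (norm (f t))\<^sup>2)"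
    using assms(1) unfolding L2_between_def by blast+
  show ?thesis
    unfolding L2_between_def
    using measurable_restrict_mono[OF f sub] integrable_subinterval[OF i sub] by blast
qed

lemma L2_between_const: "L2_between a b (\<lambda>t. c)"
  by (simp add: L2_between_def)

lemma norm_diff_sq_le: "(norm (x - y))\<^sup>2 \<le> 2 * (norm x)\<^sup>2 + 2 * (norm (y::'a::real_inner))\<^sup>2"
proof -
  have "0 \<le> (norm (x + y))\<^sup>2" by simp
  then show ?thesis
    by (simp add: power2_norm_eq_inner inner_diff_left inner_diff_right inner_add_left inner_add_right inner_commute)
qed

lemma L2_between_diff:
  assumes "L2_between a b f" "L2_between a b g"
  shows "L2_between a b (\<lambda>t. f t - g t)"
proof -
  have m: "(\<lambda>t. f t - g t) \<in> borel_measurable (lebesgue_on {a..b})"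
    using assms by (auto simp: L2_between_def)
  moreover have "integrable (lebesgue_on {a..b}) (\<lambda>t. (norm (f t - g t))\<^sup>2)"
  proof (rule Bochner_Integration.integrable_bound)
    show "integrable (lebesgue_on {a..b}) (\<lambda>t. 2 * (norm (f t))\<^sup>2 + 2 * (norm (g t))\<^sup>2)"
      using assms by (auto simp: L2_between_def)
    show "(\<lambda>t. (norm (f t - g t))\<^sup>2) \<in> borel_measurable (lebesgue_on {a..b})"
      using m by measurable
  qed (use norm_diff_sq_le in auto)
  ultimately show ?thesis by (simp add: L2_between_def)
qed

lemma L2_between_sq_integrable:
  "L2_between a b f \<Longrightarrow> integrable (lebesgue_on {a..b}) (\<lambda>t. (norm (f t))\<^sup>2)"
  by (simp add: L2_between_def)

text \<open>The interval has finite measure, so \<open>1 + (norm (f t))\<^sup>2\<close> is an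
  integrable majorant of \<open>norm (f t)\<close>.\<close>

lemma L2_between_integrable:
  assumes "L2_between a b f"
  shows "integrable (lebesgue_on {a..b}) f"
proof (rule Bochner_Integration.integrable_bound)
  show "integrable (lebesgue_on {a..b}) (\<lambda>t. 1 + (norm (f t))\<^sup>2)"
    using assms by (auto simp: L2_between_def)
  show "f \<in> borel_measurable (lebesgue_on {a..b})"
    using assms by (auto simp: L2_between_def)
  have "x \<le> 1 + x\<^sup>2" for x :: real
  proof -
    have "0 \<le> (x - 1)\<^sup>2 + x\<^sup>2 + 1" by simp
    then show ?thesis by (simp add: power2_diff)
  qed
  then show "AE t in lebesgue_on {a..b}. norm (f t) \<le> norm (1 + (norm (f t))\<^sup>2)"
    by auto
qed

text \<open>Expanding the square separates \<open>c\<close> from \<open>f\<close>: only the length,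
  the integral and the squared norm of \<open>f\<close> remain as coefficients. The continuity of
  the penalty rests on this form.\<close>

lemma integral_sq_diff_const:
  fixes f :: "real \<Rightarrow> 'a::euclidean_space"
  assumes "L2_between a b f" "a \<le> b"
  shows "(LINT t|lebesgue_on {a..b}. (norm (c - f t))\<^sup>2) =
    (b - a) * (norm c)\<^sup>2 - 2 * (c \<bullet> (LINT t|lebesgue_on {a..b}. f t))
      + (LINT t|lebesgue_on {a..b}. (norm (f t))\<^sup>2)"
proof -
  let ?M = "lebesgue_on {a..b}"
  note fi = L2_between_integrable[OF assms(1)] and fs = L2_between_sq_integrable[OF assms(1)]
  have eq: "(norm (c - f t))\<^sup>2 = (norm c)\<^sup>2 - 2 * (c \<bullet> f t) + (norm (f t))\<^sup>2" for t
    by (simp add: power2_norm_eq_inner inner_diff_left inner_diff_right inner_commute)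
  have "measure ?M {a..b} = b - a"
    using assms(2) by (simp add: measure_restrict_space)
  then show ?thesis
    unfolding eq using fi fs
    by (simp add: Bochner_Integration.integral_add Bochner_Integration.integral_diff integral_inner_right)
qed

text \<open>Pythagoras in L2: the mean \<open>p\<close> is the orthogonal projection of
  \<open>f\<close> onto the constants. Dropping the last term gives the optimality of the mean; the
  exact form is used for the delayed difference quotients, which are not means of
  \<open>dybar\<close>.\<close>

lemma integral_sq_diff_mean:
  fixes f :: "real \<Rightarrow> 'a::euclidean_space"
  assumes "L2_between a b f" "a < b"
  defines "p \<equiv> (LINT t|lebesgue_on {a..b}. f t) /\<^sub>R (b - a)"
  shows "(LINT t|lebesgue_on {a..b}. (norm (c - f t))\<^sup>2) =
    (LINT t|lebesgue_on {a..b}. (norm (p - f t))\<^sup>2) + (b - a) * (norm (c - p))\<^sup>2"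
proof -
  have I: "(LINT t|lebesgue_on {a..b}. f t) = (b - a) *\<^sub>R p"
    using assms by simp
  have c: "(norm (c - p))\<^sup>2 = (norm c)\<^sup>2 - 2 * (c \<bullet> p) + (norm p)\<^sup>2"
    by (simp add: power2_norm_eq_inner inner_diff_left inner_diff_right inner_commute)
  have i: "c \<bullet> ((b - a) *\<^sub>R p) = (b - a) * (c \<bullet> p)" "p \<bullet> ((b - a) *\<^sub>R p) = (b - a) * (norm p)\<^sup>2"
    by (simp_all add: power2_norm_eq_inner)
  show ?thesis
    unfolding integral_sq_diff_const[OF assms(1) less_imp_le[OF assms(2)]] I c i
    by algebra
qed

text \<open>Cauchy-Schwarz, read off from the nonnegativity of the squared distance between
  \<open>f\<close> and its mean. The mean divides by \<open>b - a\<close>, hence the separate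
  degenerate case, which does occur later for delayed nodes clamped to \<open>0\<close>.\<close>

lemma norm_integral_sq_le:
  fixes f :: "real \<Rightarrow> 'a::euclidean_space"
  assumes "L2_between a b f" "a \<le> b"
  shows "(norm (LINT t|lebesgue_on {a..b}. f t))\<^sup>2 \<le> (b - a) * (LINT t|lebesgue_on {a..b}. (norm (f t))\<^sup>2)"
proof (cases "a = b")
  case True
  have "(LINT t|lebesgue_on {a..b}. f t) = 0"
    unfolding True by (rule integral_eq_zero_null_sets) auto
  then show ?thesis using True by simp
next
  case False
  then have ab: "a < b" using assms by simp
  define I where "I = (LINT t|lebesgue_on {a..b}. f t)"
  have "0 \<le> (LINT t|lebesgue_on {a..b}. (norm (I /\<^sub>R (b - a) - f t))\<^sup>2)"
    by (simp add: integral_nonneg_AE)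
  also have "\<dots> = (LINT t|lebesgue_on {a..b}. (norm (f t))\<^sup>2) - (norm I)\<^sup>2 / (b - a)"
  proof -
    have "(b - a) * (norm (I /\<^sub>R (b - a)))\<^sup>2 = (norm I)\<^sup>2 / (b - a)"
      using ab by (simp add: power_mult_distrib power2_eq_square divide_inverse)
    moreover have "(I /\<^sub>R (b - a)) \<bullet> I = (norm I)\<^sup>2 / (b - a)"
      using ab by (simp add: power2_norm_eq_inner divide_inverse)
    ultimately show ?thesis
      unfolding integral_sq_diff_const[OF assms] I_def[symmetric] by linarith
  qed
  finally show ?thesis using ab unfolding I_def[symmetric] by (simp add: pos_divide_le_eq mult.commute)
qed

text \<open>Adjacent cells share only an endpoint, a null set. Weak monotonicity of
  \<open>\<tau>\<close> admits degenerate cells, as needed for clamped delayed nodes.\<close>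

lemma integral_sum_cells:
  fixes f :: "real \<Rightarrow> 'a::euclidean_space"
  assumes "mono \<tau>" "integrable (lebesgue_on {\<tau> 0..\<tau> n}) f"
  shows "(\<Sum>i<n. LINT t|lebesgue_on {\<tau> i..\<tau> (Suc i)}. f t) = (LINT t|lebesgue_on {\<tau> 0..\<tau> n}. f t)"
  using assms(2)
proof (induction n)
  case 0
  have "(LINT t|lebesgue_on {\<tau> 0}. f t) = 0"
    by (rule integral_eq_zero_null_sets) auto
  then show ?case by simp
next
  case (Suc n)
  have le: "\<tau> 0 \<le> \<tau> n" and le2: "\<tau> n \<le> \<tau> (Suc n)"
    using assms(1) by (simp_all add: monoD)
  have i: "integrable (lebesgue_on {\<tau> 0..\<tau> n}) f"
    by (rule integrable_subinterval[OF Suc.prems]) (use le2 in auto)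
  show ?case
    by (simp add: Suc.IH[OF i] integral_combine[OF Suc.prems le le2])
qed

text \<open>Continuous functions that converge almost everywhere to \<open>f\<close> are made to converge in
  \<open>L\<^sup>2\<close> by composing them with the projection onto a large ball.\<close>

lemma L2_between_approx_continuous:
  fixes f :: "real \<Rightarrow> 'a::euclidean_space"
  assumes f: "L2_between a b f" and "0 < e"
  obtains g :: "real \<Rightarrow> 'a" where "continuous_on UNIV g" "(LINT t|lebesgue_on {a..b}. (norm (g t - f t))\<^sup>2) < e"
proof -
  let ?M = "lebesgue_on {a..b}"
  define c :: "nat \<Rightarrow> 'a \<Rightarrow> 'a" where "c n = closest_point (cball 0 (real n))" for n
  have cc: "continuous_on UNIV (c n)" for n
    unfolding c_def by (intro continuous_on_closest_point) auto
  have cid: "c n x = x" if "norm x \<le> real n" for n x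
    unfolding c_def using that by (intro closest_point_self) auto
  have cn: "norm (c n x) \<le> real n" for n x
    using closest_point_in_set[of "cball 0 (real n)" x] by (simp add: c_def)
  \<comment> \<open>The projection is 1-Lipschitz and fixes \<open>0\<close>, so truncation does not
    increase norms; this yields the majorant \<open>4 * (norm (f t))\<^sup>2\<close> below.\<close>
  have cx: "norm (c n x) \<le> norm x" for n x
    using closest_point_lipschitz[of "cball 0 (real n)" x 0] cid[of 0 n] by (simp add: c_def)
  have fm: "f \<in> borel_measurable ?M" and fs: "integrable ?M (\<lambda>t. (norm (f t))\<^sup>2)"
    using f unfolding L2_between_def by blast+
  have cfm: "(\<lambda>t. c n (f t)) \<in> borel_measurable ?M" for n
    by (rule borel_measurable_continuous_on[OF cc fm])
  have "(\<lambda>n. LINT t|?M. (norm (c n (f t) - f t))\<^sup>2) \<longlonglongrightarrow> (LINT t|?M. 0)"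
  proof (rule integral_dominated_convergence)
    show "integrable ?M (\<lambda>t. 4 * (norm (f t))\<^sup>2)" using fs by simp
    show "(\<lambda>t. (norm (c n (f t) - f t))\<^sup>2) \<in> borel_measurable ?M" for n
      using cfm[of n] fm by measurable
    have "(\<lambda>n. (norm (c n x - x))\<^sup>2) \<longlonglongrightarrow> 0" for x
    proof (rule tendsto_eventually)
      obtain k where "norm x \<le> real k" using real_arch_simple by blast
      then show "\<forall>\<^sub>F n in sequentially. (norm (c n x - x))\<^sup>2 = 0"
        by (intro eventually_sequentiallyI[of k]) (simp add: cid)
    qed
    then show "AE t in ?M. (\<lambda>n. (norm (c n (f t) - f t))\<^sup>2) \<longlonglongrightarrow> 0" by simp
    have "norm ((norm (c n x - x))\<^sup>2) \<le> 4 * (norm x)\<^sup>2" for n x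
    proof -
      have "norm (c n x - x) \<le> 2 * norm x"
        using norm_triangle_ineq4[of "c n x" x] cx[of n x] by linarith
      then have "(norm (c n x - x))\<^sup>2 \<le> (2 * norm x)\<^sup>2" by (intro power_mono) auto
      then show ?thesis by (simp add: power_mult_distrib)
    qed
    then show "AE t in ?M. norm ((norm (c n (f t) - f t))\<^sup>2) \<le> 4 * (norm (f t))\<^sup>2" for n by simp
  qed simp
  \<comment> \<open>The truncation error and the later approximation error each get
    \<open>e / 4\<close>, because \<open>norm_diff_sq_le\<close> doubles both of them.\<close>
  then have "\<forall>\<^sub>F n in sequentially. (LINT t|?M. (norm (c n (f t) - f t))\<^sup>2) < e / 4"
    using \<open>0 < e\<close> by (intro order_tendstoD(2)) auto
  then obtain n where n: "(LINT t|?M. (norm (c n (f t) - f t))\<^sup>2) < e / 4"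
    using eventually_happens'[OF sequentially_bot] by blast
  \<comment> \<open>This notion of measurability supplies continuous functions converging off a
    negligible set, but with no bound; composing with \<open>c n\<close> adds the bound that
    dominated convergence requires.\<close>
  have "f measurable_on {a..b}"
    using fm by (simp add: measurable_on_iff_borel_measurable)
  then obtain N g where N: "negligible N" and g: "\<And>k. continuous_on UNIV (g k)"
    and lim: "\<And>t. t \<notin> N \<Longrightarrow> (\<lambda>k. g k t) \<longlonglongrightarrow> (if t \<in> {a..b} then f t else 0)"
    unfolding measurable_on_def by blast
  have cg: "continuous_on UNIV (\<lambda>t. c n (g k t))" for k
    by (rule continuous_on_compose2[OF cc g]) auto
  have cgm: "(\<lambda>t. c n (g k t)) \<in> borel_measurable ?M" for k
    by (rule continuous_imp_measurable_on_sets_lebesgue[OF continuous_on_subset[OF cg]]) auto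
  have bnd: "(norm (c n x - c n y))\<^sup>2 \<le> (2 * real n)\<^sup>2" for x y
    using norm_triangle_ineq4[of "c n x" "c n y"] cn[of n x] cn[of n y] by (intro power_mono) auto
  have "(\<lambda>k. LINT t|?M. (norm (c n (g k t) - c n (f t)))\<^sup>2) \<longlonglongrightarrow> (LINT t|?M. 0)"
  proof (rule integral_dominated_convergence)
    show "integrable ?M (\<lambda>t. (2 * real n)\<^sup>2)" by simp
    show "(\<lambda>t. (norm (c n (g k t) - c n (f t)))\<^sup>2) \<in> borel_measurable ?M" for k
      using cgm[of k] cfm[of n] by measurable
    have "(\<lambda>k. (norm (c n (g k t) - c n (f t)))\<^sup>2) \<longlonglongrightarrow> 0" if "t \<in> {a..b}" "t \<notin> N" for t
    proof -
      have "(\<lambda>k. c n (g k t)) \<longlonglongrightarrow> c n (f t)"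
        using lim[of t] that by (intro continuous_on_tendsto_compose[OF cc]) auto
      then have "(\<lambda>k. (norm (c n (g k t) - c n (f t)))\<^sup>2) \<longlonglongrightarrow> (norm (c n (f t) - c n (f t)))\<^sup>2"
        by (intro tendsto_intros)
      then show ?thesis by simp
    qed
    moreover have "AE t in ?M. t \<notin> N"
      using AE_not_in[of N lebesgue] N
      by (subst AE_restrict_space_iff) (auto simp: negligible_iff_null_sets)
    ultimately show "AE t in ?M. (\<lambda>k. (norm (c n (g k t) - c n (f t)))\<^sup>2) \<longlonglongrightarrow> 0"
      by (auto elim!: lebesgue_on_mono)
    show "AE t in ?M. norm ((norm (c n (g k t) - c n (f t)))\<^sup>2) \<le> (2 * real n)\<^sup>2" for k
      using bnd by simp
  qed simp
  then have "\<forall>\<^sub>F k in sequentially. (LINT t|?M. (norm (c n (g k t) - c n (f t)))\<^sup>2) < e / 4"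
    using \<open>0 < e\<close> by (intro order_tendstoD(2)) auto
  then obtain k where k: "(LINT t|?M. (norm (c n (g k t) - c n (f t)))\<^sup>2) < e / 4"
    using eventually_happens'[OF sequentially_bot] by blast
  have const: "integrable ?M (\<lambda>t. (real n)\<^sup>2)" by simp
  have cL: "L2_between a b (\<lambda>t. c n (h t))" if "(\<lambda>t. c n (h t)) \<in> borel_measurable ?M" for h
    unfolding L2_between_def
  proof (intro conjI that Bochner_Integration.integrable_bound[OF const])
    show "(\<lambda>t. (norm (c n (h t)))\<^sup>2) \<in> borel_measurable ?M"
      using that by measurable
    show "AE t in ?M. norm ((norm (c n (h t)))\<^sup>2) \<le> norm ((real n)\<^sup>2)"
      using cn by (auto intro!: power_mono)
  qed
  have 1: "integrable ?M (\<lambda>t. (norm (c n (g k t) - c n (f t)))\<^sup>2)"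
    by (intro L2_between_sq_integrable L2_between_diff cL cgm cfm)
  have 2: "integrable ?M (\<lambda>t. (norm (c n (f t) - f t))\<^sup>2)"
    by (intro L2_between_sq_integrable L2_between_diff cL cfm f)
  have 3: "integrable ?M (\<lambda>t. (norm (c n (g k t) - f t))\<^sup>2)"
    by (intro L2_between_sq_integrable L2_between_diff cL cgm f)
  have "(LINT t|?M. (norm (c n (g k t) - f t))\<^sup>2)
     \<le> (LINT t|?M. 2 * (norm (c n (g k t) - c n (f t)))\<^sup>2 + 2 * (norm (c n (f t) - f t))\<^sup>2)"
  proof (intro integral_mono 3)
    show "(norm (c n (g k t) - f t))\<^sup>2
        \<le> 2 * (norm (c n (g k t) - c n (f t)))\<^sup>2 + 2 * (norm (c n (f t) - f t))\<^sup>2" for t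
      using norm_diff_sq_le[of "c n (g k t) - c n (f t)" "f t - c n (f t)"] by (simp add: norm_minus_commute)
  qed (use 1 2 in auto)
  also have "\<dots> = 2 * (LINT t|?M. (norm (c n (g k t) - c n (f t)))\<^sup>2) + 2 * (LINT t|?M. (norm (c n (f t) - f t))\<^sup>2)"
    using 1 2 by simp
  also have "\<dots> < e" using n k by simp
  finally show ?thesis using that[OF cg] by blast
qed

subsection \<open>Cell means\<close>

lemma mesh_pos: "0 < T \<Longrightarrow> 0 < mesh T m"
  by (simp add: mesh_def)

lemma mesh_tendsto_0: "(\<lambda>m. mesh T m) \<longlonglongrightarrow> 0"
  unfolding mesh_def by (rule LIMSEQ_divide_realpow_zero) simp

lemma node_0 [simp]: "node T m 0 = 0"
  by (simp add: node_def)

lemma node_Suc: "node T m (Suc i) = node T m i + mesh T m"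
  by (simp add: node_def algebra_simps)

lemma node_last [simp]: "node T m (2 ^ m) = T"
  by (simp add: node_def mesh_def)

lemma mono_node: "0 < T \<Longrightarrow> mono (node T m)"
  by (auto intro!: monoI divide_right_mono mult_right_mono simp: node_def mesh_def)

lemma node_mem:
  assumes "0 < T" "i \<le> 2 ^ m"
  shows "node T m i \<in> {0..T}"
  using monoD[OF mono_node[OF assms(1), of m], of 0 i] monoD[OF mono_node[OF assms(1), of m] assms(2)] by simp

lemma cell_subset:
  assumes "0 < T" "i < 2 ^ m"
  shows "{node T m i..node T m (Suc i)} \<subseteq> {0..T}"
  using node_mem[OF assms(1), of i m] node_mem[OF assms(1), of "Suc i" m] assms by auto

lemma L2_on_cell:
  assumes "0 < T" "i < 2 ^ m" "L2_on T f"
  shows "L2_between (node T m i) (node T m (Suc i)) f"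
  using node_mem[OF assms(1), of i m] node_mem[OF assms(1), of "Suc i" m] assms
  by (auto simp: L2_on_iff_L2_between intro: L2_between_subinterval)

text \<open>The index is the one computed by \<open>interpolant\<close>. At the right end of the
  interval it is \<open>2 ^ m\<close>, one past the last cell; the final clause records that this
  happens only at \<open>t = T\<close>.\<close>

lemma cell_of:
  assumes T: "0 < T" and t: "t \<in> {0..T}"
  obtains k where "k = nat \<lfloor>t / mesh T m\<rfloor>" "k \<le> 2 ^ m" "node T m k \<le> t" "t < node T m (Suc k)" "k = 2 ^ m \<Longrightarrow> t = T"
proof -
  define k where "k = nat \<lfloor>t / mesh T m\<rfloor>"
  have h: "0 < mesh T m" by (rule mesh_pos[OF T])
  have Tm: "T = 2 ^ m * mesh T m" by (simp add: mesh_def)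
  have "0 \<le> t / mesh T m" using h t by simp
  then have k: "real k \<le> t / mesh T m" "t / mesh T m < real k + 1" by (simp_all add: k_def)
  have "t / mesh T m \<le> 2 ^ m" using t Tm h by (simp add: pos_divide_le_eq)
  then have "real k \<le> 2 ^ m" using k by linarith
  then have kn: "k \<le> 2 ^ m" by (metis of_nat_le_iff of_nat_numeral of_nat_power)
  have n: "node T m k \<le> t" using k(1) h by (simp add: node_def pos_le_divide_eq)
  have "t < node T m (Suc k)" using k(2) h by (simp add: node_def pos_divide_less_eq algebra_simps)
  moreover have "t = T" if "k = 2 ^ m" using n t that by simp
  ultimately show ?thesis using that[OF k_def kn n] by blast
qed

lemma sum_cells:
  fixes f :: "real \<Rightarrow> real"
  assumes "0 < T" "integrable (lebesgue_on {0..T}) f"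
  shows "(\<Sum>i<2 ^ m. LINT t|lebesgue_on {node T m i..node T m (Suc i)}. f t) = (LINT t|lebesgue_on {0..T}. f t)"
  using integral_sum_cells[OF mono_node[OF assms(1)], where n = "2 ^ m" and f = f and m1 = m] assms(2) by simp

text \<open>On each cell the mean does at least as well as any constant, in particular the left
  nodal value of a continuous \<open>g\<close> that is close to \<open>f\<close> in L2. Uniform
  continuity makes that value close to \<open>g\<close> on the whole cell once the mesh is
  small.\<close>

lemma cell_means_tendsto:
  fixes f :: "real \<Rightarrow> 'a::euclidean_space"
  assumes T: "0 < T" and f: "L2_on T f"
  shows "(\<lambda>m. \<Sum>i<2 ^ m. LINT t|lebesgue_on {node T m i..node T m (Suc i)}.
      (norm ((LINT s|lebesgue_on {node T m i..node T m (Suc i)}. f s) /\<^sub>R mesh T m - f t))\<^sup>2) \<longlonglongrightarrow> 0"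
    (is "?S \<longlonglongrightarrow> 0")
proof (rule LIMSEQ_I)
  fix e :: real assume e: "0 < e"
  obtain g where g: "continuous_on UNIV g" and gf: "(LINT t|lebesgue_on {0..T}. (norm (g t - f t))\<^sup>2) < e / 4"
    using L2_between_approx_continuous[of 0 T f "e / 4"] e f L2_on_iff_L2_between by (metis zero_less_divide_iff zero_less_numeral)
  \<comment> \<open>With this choice the oscillation of \<open>g\<close> contributes
    \<open>2 * \<eta>\<^sup>2 * T = e / 4\<close> in total, and the L2 distance of \<open>g\<close>
    and \<open>f\<close> contributes less than \<open>e / 2\<close>.\<close>
  define \<eta> where "\<eta> = sqrt (e / (8 * T))"
  have eta: "0 < \<eta>" "\<eta>\<^sup>2 = e / (8 * T)" using e T by (auto simp: \<eta>_def)
  have gL: "L2_between 0 T g"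
    unfolding L2_between_def
    by (intro conjI continuous_imp_measurable_on_sets_lebesgue continuous_on_subset[OF g]
         continuous_imp_integrable_real continuous_intros) auto
  have "uniformly_continuous_on {0..T} g"
    by (intro compact_uniformly_continuous continuous_on_subset[OF g]) auto
  then obtain d where d: "0 < d" "\<And>s t. s \<in> {0..T} \<Longrightarrow> t \<in> {0..T} \<Longrightarrow> dist s t < d \<Longrightarrow> dist (g s) (g t) < \<eta>"
    using eta(1) unfolding uniformly_continuous_on_def by metis
  have "\<forall>\<^sub>F m in sequentially. mesh T m < d"
    using mesh_tendsto_0 d(1) by (rule order_tendstoD(2))
  then obtain M where M: "\<And>m. M \<le> m \<Longrightarrow> mesh T m < d"
    unfolding eventually_sequentially by blast
  have "norm (?S m - 0) < e" if m: "M \<le> m" for m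
  proof -
    have cell: "(LINT t|lebesgue_on {node T m i..node T m (Suc i)}.
        (norm ((LINT s|lebesgue_on {node T m i..node T m (Suc i)}. f s) /\<^sub>R mesh T m - f t))\<^sup>2)
        \<le> 2 * (\<eta>\<^sup>2 * mesh T m) + 2 * (LINT t|lebesgue_on {node T m i..node T m (Suc i)}. (norm (g t - f t))\<^sup>2)"
      if i: "i < 2 ^ m" for i
    proof -
      let ?a = "node T m i" and ?b = "node T m (Suc i)"
      let ?M = "lebesgue_on {?a..?b}"
      have ab: "?a < ?b" "?b - ?a = mesh T m" using mesh_pos[OF T] by (simp_all add: node_Suc)
      have fc: "L2_between ?a ?b f" by (rule L2_on_cell[OF T i f])
      have gc: "L2_between ?a ?b g"
        using L2_on_cell[OF T i] gL by (simp add: L2_on_iff_L2_between)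
      have int: "integrable ?M (\<lambda>t. (norm (g t - f t))\<^sup>2)"
        by (intro L2_between_sq_integrable L2_between_diff fc gc)
      \<comment> \<open>The mean is the best constant approximation, so it beats the value of \<open>g\<close> at the node.\<close>
      have "(LINT t|?M. (norm ((LINT s|?M. f s) /\<^sub>R mesh T m - f t))\<^sup>2) \<le> (LINT t|?M. (norm (g ?a - f t))\<^sup>2)"
        using integral_sq_diff_mean[OF fc ab(1), of "g ?a"] ab mesh_pos[OF T, of m] by simp
      also have "\<dots> \<le> (LINT t|?M. 2 * \<eta>\<^sup>2 + 2 * (norm (g t - f t))\<^sup>2)"
      proof (rule integral_mono)
        show "integrable ?M (\<lambda>t. (norm (g ?a - f t))\<^sup>2)"
          by (intro L2_between_sq_integrable L2_between_diff fc L2_between_const)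
        show "integrable ?M (\<lambda>t. 2 * \<eta>\<^sup>2 + 2 * (norm (g t - f t))\<^sup>2)" using int by simp
        fix t assume "t \<in> space ?M"
        then have t: "t \<in> {?a..?b}" by simp
        have "dist (g ?a) (g t) < \<eta>"
          using t ab M[OF m] cell_subset[OF T i] by (intro d(2)) (auto simp: dist_real_def)
        then have "(norm (g ?a - g t))\<^sup>2 \<le> \<eta>\<^sup>2" by (intro power_mono) (auto simp: dist_norm)
        then show "(norm (g ?a - f t))\<^sup>2 \<le> 2 * \<eta>\<^sup>2 + 2 * (norm (g t - f t))\<^sup>2"
          using norm_diff_sq_le[of "g ?a - g t" "f t - g t"] by (simp add: norm_minus_commute)
      qed
      also have "\<dots> = 2 * (\<eta>\<^sup>2 * mesh T m) + 2 * (LINT t|?M. (norm (g t - f t))\<^sup>2)"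
        using int ab by (simp add: measure_restrict_space)
      finally show ?thesis .
    qed
    have "?S m \<le> (\<Sum>i<2 ^ m. 2 * (\<eta>\<^sup>2 * mesh T m) + 2 * (LINT t|lebesgue_on {node T m i..node T m (Suc i)}. (norm (g t - f t))\<^sup>2))"
      using cell by (intro sum_mono) auto
    also have "\<dots> = 2 * \<eta>\<^sup>2 * (2 ^ m * mesh T m) + 2 * (LINT t|lebesgue_on {0..T}. (norm (g t - f t))\<^sup>2)"
    proof -
      have "integrable (lebesgue_on {0..T}) (\<lambda>t. (norm (g t - f t))\<^sup>2)"
        using f by (intro L2_between_sq_integrable L2_between_diff gL) (simp add: L2_on_iff_L2_between)
      then show ?thesis
        by (simp add: sum.distrib sum_cells[OF T] flip: sum_distrib_left)
    qed
    also have "\<dots> < e"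
      using gf e T by (simp add: eta mesh_def)
    finally have "?S m < e" .
    moreover have "0 \<le> ?S m" by (intro sum_nonneg integral_nonneg_AE) auto
    ultimately show ?thesis by simp
  qed
  then show "\<exists>no. \<forall>m\<ge>no. norm (?S m - 0) < e" by blast
qed

subsection \<open>Existence of optimal solutions of feasible discrete problems\<close>

lemma continuous_on_UNIV_tendsto_nhds:
  assumes "continuous_on UNIV f"
  shows "(f \<longlongrightarrow> f p) (nhds p)"
proof -
  have "(f \<longlongrightarrow> f p) (at p)"
    using assms by (simp add: continuous_on_def)
  then show ?thesis
    unfolding tendsto_at_iff_tendsto_nhds .
qed

lemma lower_semicontinuous_compose:
  assumes "lower_semicontinuous f" "continuous_on UNIV h"
  shows "lower_semicontinuous (\<lambda>p. f (h p))"
  unfolding lower_semicontinuous_def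
proof (intro allI impI)
  fix p a assume "a < f (h p)"
  then have "\<forall>\<^sub>F y in nhds (h p). a < f y"
    using assms(1) by (simp add: lower_semicontinuous_def)
  moreover have "filterlim h (nhds (h p)) (nhds p)"
    using assms(2) by (rule continuous_on_UNIV_tendsto_nhds)
  ultimately show "\<forall>\<^sub>F q in nhds p. a < f (h q)"
    by (rule eventually_compose_filterlim)
qed

lemma lower_semicontinuous_continuous:
  assumes "continuous_on UNIV f"
  shows "lower_semicontinuous f"
  unfolding lower_semicontinuous_def
proof (intro allI impI)
  fix p a assume "a < f p"
  moreover have "filterlim f (nhds (f p)) (nhds p)"
    using assms by (rule continuous_on_UNIV_tendsto_nhds)
  ultimately show "\<forall>\<^sub>F q in nhds p. a < f q"
    by (simp add: order_tendstoD(1))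
qed

lemma lower_semicontinuous_add:
  assumes "lower_semicontinuous f" "lower_semicontinuous g"
  shows "lower_semicontinuous (\<lambda>p. f p + g p)"
  unfolding lower_semicontinuous_def
proof (intro allI impI)
  fix p a assume a: "a < f p + g p"
  \<comment> \<open>Half of the surplus over \<open>a\<close>, so that losing \<open>d\<close> in
    each summand still leaves \<open>a\<close>.\<close>
  define d where "d = (f p + g p - a) / 2"
  have "0 < d" using a by (simp add: d_def)
  then have "\<forall>\<^sub>F q in nhds p. f p - d < f q" "\<forall>\<^sub>F q in nhds p. g p - d < g q"
    using assms by (simp_all add: lower_semicontinuous_def)
  then show "\<forall>\<^sub>F q in nhds p. a < f q + g q"
    by eventually_elim (simp add: d_def field_simps)
qed

text \<open>If no minimum existed, the sets \<open>V y\<close> with \<open>y\<close> in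
  \<open>S\<close>, open by lower semicontinuity, would cover \<open>S\<close>. Among the finitely
  many indices of a subcover, one with the least value of \<open>f\<close> lies in none of the
  chosen sets.\<close>

lemma lower_semicontinuous_attains_inf:
  assumes f: "lower_semicontinuous f" and S: "compact S" "S \<noteq> {}"
  obtains (min) x where "x \<in> S" "\<And>y. y \<in> S \<Longrightarrow> f x \<le> f y"
proof (rule ccontr)
  assume no: "\<not> thesis"
  have *: "\<exists>y\<in>S. f y < f x" if x: "x \<in> S" for x
  proof (rule ccontr)
    assume "\<not> (\<exists>y\<in>S. f y < f x)"
    then have "f x \<le> f y" if "y \<in> S" for y
      using that by force
    then show False using no min[OF x] by blast
  qed
  define V where "V y = {x. f y < f x}" for y
  have op: "open (V y)" for y
  proof (subst open_subopen, intro ballI)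
    fix x assume "x \<in> V y"
    then have "\<forall>\<^sub>F z in nhds x. f y < f z" using f by (simp add: lower_semicontinuous_def V_def)
    then show "\<exists>W. open W \<and> x \<in> W \<and> W \<subseteq> V y"
      unfolding eventually_nhds V_def by auto
  qed
  have "S \<subseteq> (\<Union>y\<in>S. V y)"
    using * by (auto simp: V_def)
  then obtain D where D: "D \<subseteq> S" "finite D" "S \<subseteq> (\<Union>y\<in>D. V y)"
    by (rule compactE_image[OF S(1) op])
  have "D \<noteq> {}" using D(3) S(2) by auto
  then obtain y where y: "y \<in> D" "\<And>z. z \<in> D \<Longrightarrow> f y \<le> f z"
    using arg_min_if_finite(1)[OF D(2), of f] arg_min_least[OF D(2), where f = f] by blast
  then obtain z where "z \<in> D" "y \<in> V z" using D by blast
  then show False using y(2)[of z] by (simp add: V_def)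
qed

section \<open>Finitely many relevant entries, and closedness of the discrete constraints\<close>

lemma closed_polyhedral_set: "closed (polyhedral_set xstar c s)"
  unfolding polyhedral_set_def by (intro closed_INT ballI closed_halfspace_le)

text \<open>A nonnegative delay keeps the delayed time at or below \<open>T\<close>, so the
  interpolation reads no entry beyond \<open>2 ^ m\<close> with a nonzero coefficient.\<close>

lemma delayed_state_cong:
  assumes T: "0 < T" and "i \<le> 2 ^ m" and \<delta>: "\<forall>t\<in>{0..T}. 0 \<le> \<delta> t"
    and eq: "\<And>k. k \<le> 2 ^ m \<Longrightarrow> x k = x' k"
  shows "delayed_state T \<delta> hist m x i = delayed_state T \<delta> hist m x' i"
proof -
  define t where "t = node T m i - \<delta> (node T m i)"
  have tT: "t \<le> T" using node_mem[OF T \<open>i \<le> 2 ^ m\<close>] \<delta> by (force simp: t_def)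
  have "interpolant T hist m x t = interpolant T hist m x' t"
  proof (cases "t \<le> 0")
    case True
    then show ?thesis by (simp add: interpolant_def)
  next
    case False
    then have "t \<in> {0..T}" using tT by simp
    then obtain k where k: "k = nat \<lfloor>t / mesh T m\<rfloor>" "k \<le> 2 ^ m" "k = 2 ^ m \<Longrightarrow> t = T"
      using cell_of[OF T, of t m] by blast
    have "((t - node T m k) / mesh T m) *\<^sub>R (x (Suc k) - x k)
        = ((t - node T m k) / mesh T m) *\<^sub>R (x' (Suc k) - x' k)"
    \<comment> \<open>Here the entry \<open>x (Suc k)\<close> lies outside the range of
      \<open>eq\<close>, but \<open>t = T\<close> is the node itself and the coefficient is
      \<open>0\<close>.\<close>
    proof (cases "k = 2 ^ m")
      case True
      then have "t - node T m k = 0" using k(3) by simp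
      then show ?thesis by simp
    next
      case ne: False
      then show ?thesis using eq[of k] eq[of "Suc k"] k(2) by simp
    qed
    then show ?thesis
      unfolding interpolant_def Let_def k(1)[symmetric] using False eq[OF k(2)] by simp
  qed
  then show ?thesis by (simp add: delayed_state_def t_def)
qed

lemma penalty_cong:
  assumes "0 < T" "\<forall>t\<in>{0..T}. 0 \<le> \<delta> t"
    and "\<And>k. k \<le> 2 ^ m \<Longrightarrow> x k = x' k" "\<And>k. k < 2 ^ m \<Longrightarrow> u k = u' k"
  shows "penalty T \<delta> hist dx dy ub m x u = penalty T \<delta> hist dx dy ub m x' u'"
proof -
  have "delayed_state T \<delta> hist m x i = delayed_state T \<delta> hist m x' i" if "i \<le> 2 ^ m" for i
    using delayed_state_cong[OF assms(1) that assms(2), where x = x and x' = x'] assms(3) by blast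
  then show ?thesis
    unfolding penalty_def Let_def
    using assms(3,4) by (intro sum.cong refl) simp
qed

lemma discrete_feasible_cong:
  assumes "0 < T" "\<forall>t\<in>{0..T}. 0 \<le> \<delta> t"
    and "\<And>k. k \<le> 2 ^ m \<Longrightarrow> x k = x' k" "\<And>k. k < 2 ^ m \<Longrightarrow> u k = u' k"
  shows "discrete_feasible T C U g \<delta> hist L \<epsilon> xb dx dy ub r \<rho> m x u \<longleftrightarrow>
    discrete_feasible T C U g \<delta> hist L \<epsilon> xb dx dy ub r \<rho> m x' u'"
proof -
  have d: "delayed_state T \<delta> hist m x i = delayed_state T \<delta> hist m x' i" if "i \<le> 2 ^ m" for i
    using delayed_state_cong[OF assms(1) that assms(2), where x = x and x' = x'] assms(3) by blast
  have p: "penalty T \<delta> hist dx dy ub m x u = penalty T \<delta> hist dx dy ub m x' u'"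
    using assms by (rule penalty_cong)
  show ?thesis
    unfolding discrete_feasible_def Let_def p using d assms(3,4) by simp
qed

lemma penalty_eq_sum:
  assumes T: "0 < T" and L2: "L2_on T dx" "L2_on T dy" "L2_on T ub"
  shows "penalty T \<delta> hist dx dy ub m x u =
    (\<Sum>i<2 ^ m. LINT t|lebesgue_on {node T m i..node T m (Suc i)}.
        (norm ((x (Suc i) - x i) /\<^sub>R mesh T m - dx t))\<^sup>2) +
    (\<Sum>i<2 ^ m. LINT t|lebesgue_on {node T m i..node T m (Suc i)}.
        (norm ((delayed_state T \<delta> hist m x (Suc i) - delayed_state T \<delta> hist m x i) /\<^sub>R mesh T m - dy t))\<^sup>2) +
    (\<Sum>i<2 ^ m. LINT t|lebesgue_on {node T m i..node T m (Suc i)}. (norm (u i - ub t))\<^sup>2)"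
proof -
  have "integrable (lebesgue_on {node T m i..node T m (Suc i)}) (\<lambda>t. (norm (c - f t))\<^sup>2)"
    if "i < 2 ^ m" "L2_on T f" for i c and f :: "real \<Rightarrow> 'e::euclidean_space"
    by (intro L2_between_sq_integrable L2_between_diff L2_between_const L2_on_cell T that)
  note int = this[OF _ L2(1)] this[OF _ L2(2)] this[OF _ L2(3)]
  show ?thesis
    unfolding penalty_def Let_def sum.distrib[symmetric]
    by (intro sum.cong refl) (simp add: int)
qed

text \<open>By \<open>integral_sq_diff_const\<close> each cell integral is a quadratic polynomial in
  a difference quotient or a control value, so continuity is a matter of algebra.\<close>

lemma continuous_on_penalty:
  fixes dx dy :: "real \<Rightarrow> 'a::euclidean_space" and ub :: "real \<Rightarrow> 'b::euclidean_space"
    and \<xi> :: "'p::topological_space \<Rightarrow> nat \<Rightarrow> 'a" and \<upsilon> :: "'p \<Rightarrow> nat \<Rightarrow> 'b"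
  assumes T: "0 < T" and L2: "L2_on T dx" "L2_on T dy" "L2_on T ub"
    and x: "\<And>i. continuous_on S (\<lambda>p. \<xi> p i)"
    and y: "\<And>i. continuous_on S (\<lambda>p. delayed_state T \<delta> hist m (\<xi> p) i)"
    and u: "\<And>i. continuous_on S (\<lambda>p. \<upsilon> p i)"
  shows "continuous_on S (\<lambda>p. penalty T \<delta> hist dx dy ub m (\<xi> p) (\<upsilon> p))"
proof -
  have "continuous_on S (\<lambda>p. LINT t|lebesgue_on {node T m i..node T m (Suc i)}. (norm (c p - f t))\<^sup>2)"
    if i: "i < 2 ^ m" and f: "L2_on T f" and c: "continuous_on S c"
    for i and c :: "'p \<Rightarrow> 'e::euclidean_space" and f :: "real \<Rightarrow> 'e"
  proof -
    have "node T m i \<le> node T m (Suc i)" using mesh_pos[OF T, of m] by (simp add: node_Suc)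
    then show ?thesis
      unfolding integral_sq_diff_const[OF L2_on_cell[OF T i f] \<open>node T m i \<le> node T m (Suc i)\<close>]
      by (intro continuous_intros c)
  qed
  note cont = this[OF _ L2(1)] this[OF _ L2(2)] this[OF _ L2(3)]
  show ?thesis
    unfolding penalty_eq_sum[OF T L2]
    by (intro continuous_on_add continuous_on_sum cont continuous_intros x y u) auto
qed

text \<open>The delayed time does not depend on the states. Branch, cell index and coefficient of
  the interpolation are therefore fixed, and the value is either constant or an affine function of
  two entries.\<close>

lemma continuous_on_delayed_state:
  fixes \<xi> :: "'p::topological_space \<Rightarrow> nat \<Rightarrow> 'a::euclidean_space"
  assumes x: "\<And>i. continuous_on S (\<lambda>p. \<xi> p i)"
  shows "continuous_on S (\<lambda>p. delayed_state T \<delta> hist m (\<xi> p) i)"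
  unfolding delayed_state_def interpolant_def Let_def
  by (cases "node T m i - \<delta> (node T m i) \<le> 0") (auto intro!: continuous_intros x)

text \<open>The step determines \<open>w\<close>, so the existential quantifier disappears. What
  remains is a membership and a family of inequalities indexed by the fixed set \<open>C\<close>, a
  form in which closedness can be read off one \<open>y\<close> at a time.\<close>

lemma step_inclusion_iff:
  assumes "0 < h"
  shows "d \<in> {- h *\<^sub>R (w - a - b) | w. w \<in> normal_cone C x} \<longleftrightarrow>
    x \<in> C \<and> (\<forall>y\<in>C. (a + b - d /\<^sub>R h) \<bullet> (y - x) \<le> 0)"
proof -
  have "d = - h *\<^sub>R (w - a - b) \<longleftrightarrow> w = a + b - d /\<^sub>R h" for w
  proof
    assume "d = - h *\<^sub>R (w - a - b)"
    then have "d /\<^sub>R h = - (w - a - b)" using assms by simp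
    then show "w = a + b - d /\<^sub>R h" by simp
  next
    assume "w = a + b - d /\<^sub>R h"
    then show "d = - h *\<^sub>R (w - a - b)" using assms by simp
  qed
  then have "d \<in> {- h *\<^sub>R (w - a - b) | w. w \<in> normal_cone C x} \<longleftrightarrow> a + b - d /\<^sub>R h \<in> normal_cone C x"
    by auto
  then show ?thesis by (simp add: normal_cone_def)
qed

lemma closed_discrete_feasible:
  fixes C :: "'a::euclidean_space set" and U :: "'b::euclidean_space set"
  assumes T: "0 < T" and C: "closed C" and U: "closed U"
    and g: "continuous_on ({0..T} \<times> UNIV) (\<lambda>(t, x, y, u). g t x y u)"
    and L2: "L2_on T dx" "L2_on T dy" "L2_on T ub"
  shows "closed {p. discrete_feasible T C U g \<delta> hist L \<epsilon> xb dx dy ub r \<rho> m (fst p) (snd p)}"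
proof -
  have x: "continuous_on UNIV (\<lambda>p :: (nat \<Rightarrow> 'a) \<times> (nat \<Rightarrow> 'b). fst p i)"
    and u: "continuous_on UNIV (\<lambda>p :: (nat \<Rightarrow> 'a) \<times> (nat \<Rightarrow> 'b). snd p i)" for i
    by (rule continuous_on_product_then_coordinatewise[OF continuous_on_fst[OF continuous_on_id]]
        continuous_on_product_then_coordinatewise[OF continuous_on_snd[OF continuous_on_id]])+
  note y = continuous_on_delayed_state[OF x]
  have gc: "continuous_on UNIV (\<lambda>p :: (nat \<Rightarrow> 'a) \<times> (nat \<Rightarrow> 'b).
      g (node T m i) (fst p i) (delayed_state T \<delta> hist m (fst p) i) (snd p i))" if "i < 2 ^ m" for i
  proof -
    have "continuous_on UNIV (\<lambda>p :: (nat \<Rightarrow> 'a) \<times> (nat \<Rightarrow> 'b).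
      (\<lambda>(t, x, y, u). g t x y u) (node T m i, fst p i, delayed_state T \<delta> hist m (fst p) i, snd p i))"
      using node_mem[OF T, of i m] that
      by (intro continuous_on_compose2[OF g] continuous_on_Pair continuous_on_const x u y) auto
    then show ?thesis by simp
  qed
  have mem: "closed {p. h p \<in> A}" if "continuous_on UNIV h" "closed A" for h :: "(nat \<Rightarrow> 'a) \<times> (nat \<Rightarrow> 'b) \<Rightarrow> 'c::topological_space" and A
    using closed_vimage[OF that(2,1)] by (simp add: vimage_def)
  have ball: "closed {p :: (nat \<Rightarrow> 'a) \<times> (nat \<Rightarrow> 'b). \<forall>i\<in>A. P i p}" if "\<And>i. i \<in> A \<Longrightarrow> closed {p. P i p}" for P and A :: "'c set"
    using closed_INT[of A "\<lambda>i. {p. P i p}"] that by (simp add: Collect_ball_eq)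
  have all: "closed {p :: (nat \<Rightarrow> 'a) \<times> (nat \<Rightarrow> 'b). \<forall>i. Q i \<longrightarrow> P i p}" if "\<And>i. Q i \<Longrightarrow> closed {p. P i p}" for P and Q :: "'c \<Rightarrow> bool"
    using ball[of "Collect Q" P] that by simp
  show ?thesis
    unfolding discrete_feasible_def Let_def step_inclusion_iff[OF mesh_pos[OF T]]
    by (intro closed_Collect_conj all ball closed_Collect_const mem C U x u;
        (intro closed_Collect_le closed_Collect_eq)?)
      (assumption | rule x u y gc continuous_on_penalty[OF T L2] continuous_on_const continuous_on_norm
        continuous_on_inner continuous_on_diff continuous_on_add continuous_on_scaleR)+
qed

text \<open>Tychonoff's theorem, transferred from \<open>product_topology\<close> to the topology of
  the function type.\<close>

lemma compact_Pi_UNIV: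
  fixes A :: "'i \<Rightarrow> 'a::topological_space set"
  assumes "\<And>i. compact (A i)"
  shows "compact (Pi UNIV A)"
proof -
  have "compactin (product_topology (\<lambda>i. euclidean) UNIV) (PiE UNIV A)"
    unfolding compactin_PiE using assms by simp
  then show ?thesis
    by (simp add: euclidean_product_topology PiE_UNIV_domain)
qed

text \<open>The speed bound telescopes from the fixed initial value. In contrast to the balls around
  \<open>xbar\<close>, which stop at index \<open>2 ^ m - 1\<close>, this also confines the final
  state.\<close>

lemma discrete_feasible_state_bound:
  assumes T: "0 < T" and F: "discrete_feasible T C U g \<delta> hist L \<epsilon> xb dx dy ub r \<rho> m x u" and "i \<le> 2 ^ m"
  shows "norm (x i - hist 0) \<le> real i * (mesh T m * L)"
  using \<open>i \<le> 2 ^ m\<close>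
proof (induction i)
  case 0
  then show ?case using F by (simp add: discrete_feasible_def Let_def)
next
  case (Suc i)
  have "norm ((x (Suc i) - x i) /\<^sub>R mesh T m) \<le> L"
    using F Suc.prems unfolding discrete_feasible_def Let_def by auto
  then have "norm (x (Suc i) - x i) / mesh T m \<le> L"
    using mesh_pos[OF T, of m] by (simp add: divide_inverse mult.commute)
  then have "norm (x (Suc i) - x i) \<le> mesh T m * L"
    using mesh_pos[OF T, of m] by (simp add: pos_divide_le_eq mult.commute)
  then show ?case
    using Suc norm_triangle_ineq[of "x (Suc i) - x i" "x i - hist 0"] by (simp add: algebra_simps)
qed

text \<open>The entries beyond \<open>2 ^ m\<close> of a decision sequence do not matter, so they may be set to \<open>0\<close>;
  this turns the feasible sequences into a compact subset of the product space.\<close>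

lemma discrete_optimal_exists:
  fixes C :: "'a::euclidean_space set" and U :: "'b::euclidean_space set"
  assumes T: "0 < T" and C: "closed C" and U: "compact U"
    and g: "continuous_on ({0..T} \<times> UNIV) (\<lambda>(t, x, y, u). g t x y u)"
    and \<delta>: "\<forall>t\<in>{0..T}. 0 \<le> \<delta> t"
    and L2: "L2_on T dx" "L2_on T dy" "L2_on T ub"
    and cost: "lower_semicontinuous cost"
    and ex: "discrete_feasible T C U g \<delta> hist L \<epsilon> xb dx dy ub r \<rho> m x0 u0"
  shows "\<exists>x u. discrete_optimal T C U g \<delta> hist cost L \<epsilon> xb dx dy ub r \<rho> m x u"
proof -
  let ?F = "\<lambda>x u. discrete_feasible T C U g \<delta> hist L \<epsilon> xb dx dy ub r \<rho> m x u"
  let ?J = "\<lambda>x u. discrete_cost T \<delta> hist cost dx dy ub m x u"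
  define A where "A i = (if i \<le> 2 ^ m then cball (hist 0) (real i * (mesh T m * L)) else {0})" for i
  define B where "B i = (if i < 2 ^ m then U else {0})" for i :: nat
  define S where "S = (Pi UNIV A \<times> Pi UNIV B) \<inter> {p. ?F (fst p) (snd p)}"
  define cx where "cx x = (\<lambda>i. if i \<le> 2 ^ m then x i else 0)" for x :: "nat \<Rightarrow> 'a"
  define cu where "cu u = (\<lambda>i. if i < 2 ^ m then u i else 0)" for u :: "nat \<Rightarrow> 'b"
  have cut: "(cx x, cu u) \<in> S" "?J (cx x) (cu u) = ?J x u" if F: "?F x u" for x u
  proof -
    have "?F (cx x) (cu u)"
      using F discrete_feasible_cong[OF T \<delta>, of m x "cx x" u "cu u"] by (simp add: cx_def cu_def)
    moreover have "cx x i \<in> A i" for i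
      using discrete_feasible_state_bound[OF T F, of i] by (simp add: cx_def A_def dist_norm norm_minus_commute)
    moreover have "cu u i \<in> B i" for i
      using F by (simp add: cu_def B_def discrete_feasible_def Let_def)
    ultimately show "(cx x, cu u) \<in> S" by (simp add: S_def)
    show "?J (cx x) (cu u) = ?J x u"
      using penalty_cong[OF T \<delta>, of m x "cx x" u "cu u"] by (simp add: discrete_cost_def cx_def cu_def)
  qed
  have "compact S"
    unfolding S_def
    by (intro compact_Int_closed compact_Times compact_Pi_UNIV
        closed_discrete_feasible[OF T C compact_imp_closed[OF U] g L2]) (simp_all add: A_def B_def U)
  moreover have "S \<noteq> {}" using cut(1)[OF ex] by blast
  moreover have "lower_semicontinuous (\<lambda>p :: (nat \<Rightarrow> 'a) \<times> (nat \<Rightarrow> 'b). ?J (fst p) (snd p))"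
  proof -
    have x: "continuous_on UNIV (\<lambda>p :: (nat \<Rightarrow> 'a) \<times> (nat \<Rightarrow> 'b). fst p i)"
      and u: "continuous_on UNIV (\<lambda>p :: (nat \<Rightarrow> 'a) \<times> (nat \<Rightarrow> 'b). snd p i)" for i
      by (rule continuous_on_product_then_coordinatewise[OF continuous_on_fst[OF continuous_on_id]]
          continuous_on_product_then_coordinatewise[OF continuous_on_snd[OF continuous_on_id]])+
    show ?thesis
      unfolding discrete_cost_def
      by (intro lower_semicontinuous_add lower_semicontinuous_continuous lower_semicontinuous_compose[OF cost]
          continuous_on_penalty[OF T L2] continuous_on_delayed_state x u)
  qed
  ultimately obtain p where p: "p \<in> S" "\<And>q. q \<in> S \<Longrightarrow> ?J (fst p) (snd p) \<le> ?J (fst q) (snd q)"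
    using lower_semicontinuous_attains_inf[of "\<lambda>p. ?J (fst p) (snd p)" S] by blast
  have "?J (fst p) (snd p) \<le> ?J x u" if "?F x u" for x u
    using p(2)[OF cut(1)[OF that]] cut(2)[OF that] by simp
  then have "discrete_optimal T C U g \<delta> hist cost L \<epsilon> xb dx dy ub r \<rho> m (fst p) (snd p)"
    using p(1) by (simp add: discrete_optimal_def S_def)
  then show ?thesis by blast
qed

subsection \<open>Feasibility for large \<open>m\<close>\<close>

lemma W12_increment:
  fixes x v :: "real \<Rightarrow> 'a::euclidean_space"
  assumes "has_W12_deriv T x v" "0 \<le> a" "a \<le> b" "b \<le> T"
  shows "x b - x a = (LINT t|lebesgue_on {a..b}. v t)"
proof -
  have "L2_between 0 b v"
    using assms by (auto simp: has_W12_deriv_def L2_on_iff_L2_between intro: L2_between_subinterval)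
  note combine = integral_combine[OF L2_between_integrable[OF this] assms(2,3)]
  have x: "x t = x 0 + (LINT s|lebesgue_on {0..t}. v s)" if "0 \<le> t" "t \<le> T" for t
    using assms(1) that unfolding has_W12_deriv_def by (meson atLeastAtMost_iff)
  show ?thesis
    unfolding x[OF assms(2) order_trans[OF assms(3,4)]] x[OF order_trans[OF assms(2,3)] assms(4)] combine by simp
qed

text \<open>\<open>cellwise_affine\<close> speaks of half-open cells; continuity carries the formula
  to the right endpoint, where the next nodal value is taken.\<close>

lemma affine_on_closed_cell:
  assumes T: "0 < T" and f: "cellwise_affine T m f" "continuous_on {0..T} f" and i: "i < 2 ^ m"
  obtains a b :: "'a::real_normed_vector" where "\<And>t. t \<in> {node T m i..node T m (Suc i)} \<Longrightarrow> f t = a + t *\<^sub>R b"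
proof -
  obtain a b where ab: "\<And>t. t \<in> {node T m i..<node T m (Suc i)} \<Longrightarrow> f t = a + t *\<^sub>R b"
    using f(1) i unfolding cellwise_affine_def by blast
  have lt: "node T m i < node T m (Suc i)" using mesh_pos[OF T, of m] by (simp add: node_Suc)
  have "f t - (a + t *\<^sub>R b) = 0" if "t \<in> {node T m i..node T m (Suc i)}" for t
  proof (rule continuous_constant_on_closure[of "{node T m i..<node T m (Suc i)}"])
    show "continuous_on (closure {node T m i..<node T m (Suc i)}) (\<lambda>t. f t - (a + t *\<^sub>R b))"
      using lt cell_subset[OF T i] by (auto intro!: continuous_intros continuous_on_subset[OF f(2)])
    show "t \<in> closure {node T m i..<node T m (Suc i)}" using that lt by simp
  qed (use ab in auto)
  then show ?thesis using that[of a b] by simp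
qed

lemma cellwise_affine_eq:
  fixes f :: "real \<Rightarrow> 'a::real_normed_vector"
  assumes T: "0 < T" and f: "cellwise_affine T m f" "continuous_on {0..T} f" and i: "i < 2 ^ m"
    and t: "t \<in> {node T m i..node T m (Suc i)}"
  shows "f t = f (node T m i) + ((t - node T m i) / mesh T m) *\<^sub>R (f (node T m (Suc i)) - f (node T m i))"
proof -
  obtain a b where ab: "\<And>t. t \<in> {node T m i..node T m (Suc i)} \<Longrightarrow> f t = a + t *\<^sub>R b"
    using affine_on_closed_cell[OF T f i] by blast
  have h: "0 < mesh T m" by (rule mesh_pos[OF T])
  have 1: "f (node T m i) = a + node T m i *\<^sub>R b" "f (node T m (Suc i)) = a + node T m (Suc i) *\<^sub>R b"
    using h by (intro ab; simp add: node_Suc)+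
  then have "f (node T m (Suc i)) - f (node T m i) = mesh T m *\<^sub>R b"
    by (simp add: node_Suc algebra_simps)
  moreover have "(t - node T m i) / mesh T m * mesh T m = t - node T m i"
    using h by simp
  ultimately show ?thesis using ab[OF t] 1(1) by (simp add: scaleR_left_diff_distrib del: nonzero_divide_eq_eq)
qed

lemma cellwise_affine_vector_derivative:
  fixes f :: "real \<Rightarrow> 'a::real_normed_vector"
  assumes T: "0 < T" and f: "cellwise_affine T m f" "continuous_on {0..T} f" and i: "i < 2 ^ m"
    and t: "t \<in> {node T m i<..<node T m (Suc i)}"
  shows "vector_derivative f (at t) = (f (node T m (Suc i)) - f (node T m i)) /\<^sub>R mesh T m"
proof (rule vector_derivative_at)
  let ?d = "f (node T m (Suc i)) - f (node T m i)"
  have "((\<lambda>t. f (node T m i) + ((t - node T m i) / mesh T m) *\<^sub>R ?d) has_vector_derivative (1 / mesh T m) *\<^sub>R ?d) (at t)"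
    by (auto intro!: derivative_eq_intros simp: divide_inverse has_vector_derivative_def)
  then have "(f has_vector_derivative (1 / mesh T m) *\<^sub>R ?d) (at t)"
  proof (rule has_vector_derivative_transform_within_open)
    fix s assume "s \<in> {node T m i<..<node T m (Suc i)}"
    then show "f (node T m i) + ((s - node T m i) / mesh T m) *\<^sub>R ?d = f s"
      by (intro cellwise_affine_eq[OF T f i, symmetric]) auto
  qed (use t in auto)
  then show "(f has_vector_derivative ?d /\<^sub>R mesh T m) (at t)" by (simp add: divide_inverse)
qed

text \<open>An affine function on a cell is determined by its two nodal values. The times are
  positive because at \<open>t \<le> 0\<close> the interpolant returns the history.\<close>

lemma interpolant_nodes:
  fixes f :: "real \<Rightarrow> 'a::real_normed_vector"
  assumes T: "0 < T" and f: "cellwise_affine T m f" "continuous_on {0..T} f"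
    and x: "\<And>i. i \<le> 2 ^ m \<Longrightarrow> x i = f (node T m i)"
    and t: "0 < t" "t \<le> T"
  shows "interpolant T hist m x t = f t"
proof -
  have tT: "t \<in> {0..T}" using t by simp
  obtain k where k: "k = nat \<lfloor>t / mesh T m\<rfloor>" "k \<le> 2 ^ m" "node T m k \<le> t" "t < node T m (Suc k)" "k = 2 ^ m \<Longrightarrow> t = T"
    using cell_of[OF T tT, of m] by blast
  have I: "interpolant T hist m x t = x k + ((t - node T m k) / mesh T m) *\<^sub>R (x (Suc k) - x k)"
    unfolding interpolant_def Let_def k(1)[symmetric] using t by simp
  show ?thesis
  proof (cases "k = 2 ^ m")
    case True
    then show ?thesis using I k(5) x[of k] by simp
  next
    case False
    then have "k < 2 ^ m" using k(2) by simp
    then show ?thesis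
      unfolding I using x[of k] x[of "Suc k"] k(3,4) cellwise_affine_eq[OF T f \<open>k < 2 ^ m\<close>, of t] by simp
  qed
qed

text \<open>Both functions start from a common value at the node to the left of \<open>t\<close> and
  move by at most \<open>L * mesh T m\<close> since then.\<close>

lemma cellwise_lipschitz_dist:
  fixes f g :: "real \<Rightarrow> 'a::real_normed_vector"
  assumes T: "0 < T" and f: "L-lipschitz_on {0..T} f" and g: "L-lipschitz_on {0..T} g"
    and eq: "\<And>i. i \<le> 2 ^ m \<Longrightarrow> f (node T m i) = g (node T m i)" and t: "t \<in> {0..T}"
  shows "norm (f t - g t) \<le> 2 * L * mesh T m"
proof -
  obtain k where k: "k \<le> 2 ^ m" "node T m k \<le> t" "t < node T m (Suc k)"
    using cell_of[OF T t] by metis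
  have d: "dist t (node T m k) \<le> mesh T m" using k by (simp add: dist_real_def node_Suc)
  have L: "0 \<le> L" by (rule lipschitz_on_nonneg[OF f])
  note n = node_mem[OF T k(1)]
  have "norm (f t - f (node T m k)) \<le> L * mesh T m" "norm (g t - g (node T m k)) \<le> L * mesh T m"
    using lipschitz_onD[OF f t n] lipschitz_onD[OF g t n] mult_left_mono[OF d L]
    unfolding dist_norm by linarith+
  then show ?thesis
    using norm_triangle_ineq4[of "f t - f (node T m k)" "g t - g (node T m k)"] eq[OF k(1)] by simp
qed

text \<open>Cauchy-Schwarz on each interval costs its length, at most \<open>M\<close>; the
  intervals do not overlap, so the remaining integrals add up to at most the one over the whole
  interval. The partition is arbitrary because it will consist of delayed nodes.\<close>

lemma sum_sq_increments_le:
  fixes w e :: "real \<Rightarrow> 'a::euclidean_space"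
  assumes s: "mono s" "0 \<le> s 0" "s n \<le> T" and M: "\<And>i. i < n \<Longrightarrow> s (Suc i) - s i \<le> M"
    and w: "L2_on T w"
    and e: "\<And>a b. 0 \<le> a \<Longrightarrow> a \<le> b \<Longrightarrow> b \<le> T \<Longrightarrow> e b - e a = (LINT t|lebesgue_on {a..b}. w t)"
    and "0 \<le> M"
  shows "(\<Sum>i<n. (norm (e (s (Suc i)) - e (s i)))\<^sup>2) \<le> M * (LINT t|lebesgue_on {0..T}. (norm (w t))\<^sup>2)"
proof -
  have w': "L2_between 0 T w" using w by (simp add: L2_on_iff_L2_between)
  have s0: "0 \<le> s i" for i using s(2) monoD[OF s(1), of 0 i] by simp
  have sT: "s i \<le> T" if "i \<le> n" for i using s(3) monoD[OF s(1) that] by simp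
  have "(norm (e (s (Suc i)) - e (s i)))\<^sup>2 \<le> M * (LINT t|lebesgue_on {s i..s (Suc i)}. (norm (w t))\<^sup>2)" if i: "i < n" for i
  proof -
    have le: "s i \<le> s (Suc i)" using s(1) by (simp add: monoD)
    have "e (s (Suc i)) - e (s i) = (LINT t|lebesgue_on {s i..s (Suc i)}. w t)"
      using sT[of "Suc i"] i by (intro e s0 le) auto
    then have "(norm (e (s (Suc i)) - e (s i)))\<^sup>2
        \<le> (s (Suc i) - s i) * (LINT t|lebesgue_on {s i..s (Suc i)}. (norm (w t))\<^sup>2)"
      using norm_integral_sq_le[OF L2_between_subinterval[OF w' s0 sT] le] i by simp
    also have "\<dots> \<le> M * (LINT t|lebesgue_on {s i..s (Suc i)}. (norm (w t))\<^sup>2)"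
      by (intro mult_right_mono M i integral_nonneg_AE) auto
    finally show ?thesis .
  qed
  then have "(\<Sum>i<n. (norm (e (s (Suc i)) - e (s i)))\<^sup>2)
      \<le> M * (\<Sum>i<n. LINT t|lebesgue_on {s i..s (Suc i)}. (norm (w t))\<^sup>2)"
    unfolding sum_distrib_left by (intro sum_mono) auto
  also have "(\<Sum>i<n. LINT t|lebesgue_on {s i..s (Suc i)}. (norm (w t))\<^sup>2) = (LINT t|lebesgue_on {s 0..s n}. (norm (w t))\<^sup>2)"
    by (intro integral_sum_cells s L2_between_sq_integrable L2_between_subinterval[OF w'])
  also have "\<dots> \<le> (LINT t|lebesgue_on {0..T}. (norm (w t))\<^sup>2)"
    using s L2_between_sq_integrable[OF w'] L2_between_sq_integrable[OF L2_between_subinterval[OF w' s(2,3)]]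
    by (intro integral_mono_lebesgue_on_AE) auto
  finally show ?thesis using \<open>0 \<le> M\<close> by (simp add: mult_left_mono)
qed

text \<open>The delayed states are values of \<open>xhat m\<close> off the nodes, so their difference quotients
  are cell means of \<open>dybar\<close> only up to the increments of \<open>xhat m - xbar\<close> between consecutive
  delayed nodes; these are controlled by the \<open>W\<^sup>1\<^sup>,\<^sup>2\<close> convergence, since the delayed nodes are
  increasing with gaps at most \<open>1 + K\<close> times the mesh.\<close>

lemma penalty_nodes_tendsto:
  fixes xbar dxbar dybar :: "real \<Rightarrow> 'a::euclidean_space" and ubar :: "real \<Rightarrow> 'b::euclidean_space"
  assumes T: "0 < T"
    and \<delta>: "\<forall>t\<in>{0..T}. 0 \<le> \<delta> t" "K-lipschitz_on {0..T} \<delta>" "antimono_on {0..T} \<delta>"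
    and dx: "has_W12_deriv T xbar dxbar" and dy: "has_W12_deriv T (\<lambda>t. xbar (t - \<delta> t)) dybar"
    and W12: "W12_tendsto T xhat xbar"
    and u: "L2_tendsto T uhat ubar" "\<And>m. cellwise_constant T m (uhat m)"
    and y: "\<And>m i. i \<le> 2 ^ m \<Longrightarrow> delayed_state T \<delta> hist m (\<lambda>i. xbar (node T m i)) i
              = xhat m (node T m i - \<delta> (node T m i))"
    and past: "\<And>m t. t \<in> {0..T} \<Longrightarrow> t - \<delta> t \<le> 0 \<Longrightarrow> xhat m (t - \<delta> t) = xbar (t - \<delta> t)"
    and init: "\<And>m. xhat m 0 = xbar 0"
  shows "(\<lambda>m. penalty T \<delta> hist dxbar dybar ubar m (\<lambda>i. xbar (node T m i)) (\<lambda>i. uhat m (node T m i)))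
    \<longlonglongrightarrow> 0"
proof -
  \<comment> \<open>\<open>v\<close> is the representative that comes with the convergence and may
    differ from \<open>dxbar\<close> on a null set. Each of them integrates to the increments of
    \<open>xbar\<close>, and it is only through increments that they enter.\<close>
  obtain vs v where vs: "\<And>m. has_W12_deriv T (xhat m) (vs m)" and v: "has_W12_deriv T xbar v"
    and vsv: "L2_tendsto T vs v"
    using W12 unfolding W12_tendsto_def by blast
  define cellint :: "nat \<Rightarrow> nat \<Rightarrow> (real \<Rightarrow> real) \<Rightarrow> real" where
    "cellint m i f = (LINT t|lebesgue_on {node T m i..node T m (Suc i)}. f t)" for m i f
  define D where "D m = (\<Sum>i<2 ^ m. cellint m i (\<lambda>t. (norm ((LINT s|lebesgue_on {node T m i..node T m (Suc i)}. dxbar s) /\<^sub>R mesh T m - dxbar t))\<^sup>2))" for m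
  define E where "E m = (\<Sum>i<2 ^ m. cellint m i (\<lambda>t. (norm ((LINT s|lebesgue_on {node T m i..node T m (Suc i)}. dybar s) /\<^sub>R mesh T m - dybar t))\<^sup>2))" for m
  define V where "V m = (LINT t|lebesgue_on {0..T}. (norm (vs m t - v t))\<^sup>2)" for m
  define W where "W m = (LINT t|lebesgue_on {0..T}. (norm (uhat m t - ubar t))\<^sup>2)" for m
  have L2: "L2_on T dxbar" "L2_on T dybar" "L2_on T ubar" "\<And>m. L2_on T (uhat m)" "\<And>m. L2_on T (vs m)" "L2_on T v"
    using dx dy u(1) vsv unfolding has_W12_deriv_def L2_tendsto_def by blast+
  have "D \<longlonglongrightarrow> 0" "E \<longlonglongrightarrow> 0"
    unfolding D_def E_def cellint_def by (intro cell_means_tendsto T L2)+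
  moreover have "V \<longlonglongrightarrow> 0" "W \<longlonglongrightarrow> 0"
    using u(1) vsv unfolding L2_tendsto_def V_def W_def by blast+
  ultimately have lim: "(\<lambda>m. D m + (E m + (1 + K) * V m) + W m) \<longlonglongrightarrow> 0"
    by (auto intro!: tendsto_eq_intros)
  have K: "0 \<le> K" by (rule lipschitz_on_nonneg[OF \<delta>(2)])
  define P where "P m = penalty T \<delta> hist dxbar dybar ubar m (\<lambda>i. xbar (node T m i)) (\<lambda>i. uhat m (node T m i))" for m
  define Y where "Y m i = delayed_state T \<delta> hist m (\<lambda>i. xbar (node T m i)) i" for m i
  have P: "P m = (\<Sum>i<2 ^ m. cellint m i (\<lambda>t. (norm ((xbar (node T m (Suc i)) - xbar (node T m i)) /\<^sub>R mesh T m - dxbar t))\<^sup>2)) +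
    (\<Sum>i<2 ^ m. cellint m i (\<lambda>t. (norm ((Y m (Suc i) - Y m i) /\<^sub>R mesh T m - dybar t))\<^sup>2)) +
    (\<Sum>i<2 ^ m. cellint m i (\<lambda>t. (norm (uhat m (node T m i) - ubar t))\<^sup>2))" for m
    unfolding P_def Y_def cellint_def by (rule penalty_eq_sum[OF T L2(1-3)])
  have nn: "0 \<le> P m" for m
    unfolding P cellint_def by (intro add_nonneg_nonneg sum_nonneg integral_nonneg_AE) auto
  \<comment> \<open>The state part of the penalty equals \<open>D m\<close>, the control part equals
    \<open>W m\<close>, and the delayed part is at most \<open>E m + (1 + K) * V m\<close>.\<close>
  have "P m \<le> D m + (E m + (1 + K) * V m) + W m" for m
  proof -
    let ?h = "mesh T m" and ?n = "node T m"
    have h: "0 < ?h" by (rule mesh_pos[OF T])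
    have nle: "?n i \<le> ?n (Suc i)" "?n i < ?n (Suc i)" "?n (Suc i) - ?n i = ?h" for i
      using h by (simp_all add: node_Suc)
    have n0: "0 \<le> ?n i" for i using h by (simp add: node_def)
    have nT: "?n i \<le> T" if "i \<le> 2 ^ m" for i using node_mem[OF T that] by simp
    have 1: "(\<Sum>i<2 ^ m. cellint m i (\<lambda>t. (norm ((xbar (?n (Suc i)) - xbar (?n i)) /\<^sub>R ?h - dxbar t))\<^sup>2)) = D m"
      unfolding D_def
    proof (intro sum.cong refl)
      fix i :: nat assume "i \<in> {..<2 ^ m}"
      then have "xbar (?n (Suc i)) - xbar (?n i) = (LINT s|lebesgue_on {?n i..?n (Suc i)}. dxbar s)"
        by (intro W12_increment[OF dx] n0 nle nT) auto
      then show "cellint m i (\<lambda>t. (norm ((xbar (?n (Suc i)) - xbar (?n i)) /\<^sub>R ?h - dxbar t))\<^sup>2)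
        = cellint m i (\<lambda>t. (norm ((LINT s|lebesgue_on {?n i..?n (Suc i)}. dxbar s) /\<^sub>R ?h - dxbar t))\<^sup>2)"
        by simp
    qed
    have 3: "(\<Sum>i<2 ^ m. cellint m i (\<lambda>t. (norm (uhat m (?n i) - ubar t))\<^sup>2)) = W m"
    proof -
      have "cellint m i (\<lambda>t. (norm (uhat m (?n i) - ubar t))\<^sup>2) = cellint m i (\<lambda>t. (norm (uhat m t - ubar t))\<^sup>2)"
        if i: "i < 2 ^ m" for i
        unfolding cellint_def
      proof (rule integral_cong_AE)
        let ?M = "lebesgue_on {?n i..?n (Suc i)}"
        note L = L2_on_cell[OF T i L2(3)] L2_on_cell[OF T i L2(4)]
        show "(\<lambda>t. (norm (uhat m (?n i) - ubar t))\<^sup>2) \<in> borel_measurable ?M"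
          "(\<lambda>t. (norm (uhat m t - ubar t))\<^sup>2) \<in> borel_measurable ?M"
          by (intro borel_measurable_integrable L2_between_sq_integrable L2_between_diff L2_between_const L)+
        obtain b where b: "\<And>t. t \<in> {?n i..<?n (Suc i)} \<Longrightarrow> uhat m t = b"
          using u(2)[of m] i unfolding cellwise_constant_def by blast
        have eq: "uhat m t = uhat m (?n i)" if "t \<in> {?n i..?n (Suc i)}" "t \<noteq> ?n (Suc i)" for t
          using b[of t] b[of "?n i"] that nle(2) by auto
        \<comment> \<open>\<open>uhat m\<close> is constant only on the half-open cell; at the right
          endpoint it may already take the next value.\<close>
        have "AE t in ?M. t \<noteq> ?n (Suc i)"
          using AE_not_in[of "{?n (Suc i)}" lebesgue] by (subst AE_restrict_space_iff) auto
        then show "AE t in ?M. (norm (uhat m (?n i) - ubar t))\<^sup>2 = (norm (uhat m t - ubar t))\<^sup>2"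
          by (rule lebesgue_on_mono) (metis eq)
      qed
      moreover have "(\<Sum>i<2 ^ m. cellint m i (\<lambda>t. (norm (uhat m t - ubar t))\<^sup>2)) = W m"
        unfolding cellint_def W_def using L2(3,4)
        by (intro sum_cells T L2_between_sq_integrable L2_between_diff) (simp_all add: L2_on_iff_L2_between)
      ultimately show ?thesis by simp
    qed
    have 2: "(\<Sum>i<2 ^ m. cellint m i (\<lambda>t. (norm ((Y m (Suc i) - Y m i) /\<^sub>R ?h - dybar t))\<^sup>2)) \<le> E m + (1 + K) * V m"
    proof -
      \<comment> \<open>\<open>s\<close> may replace \<open>\<sigma>\<close> in \<open>e\<close> because \<open>e\<close> vanishes on the history; the cap at \<open>2 ^ m\<close>
        makes \<open>s\<close> monotone on all of \<open>nat\<close>.\<close>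
      define e where "e t = xhat m t - xbar t" for t
      define \<sigma> where "\<sigma> t = t - \<delta> t" for t
      define s where "s i = max 0 (\<sigma> (?n (min i (2 ^ m))))" for i
      have "mono s"
      proof (rule monoI)
        fix i j :: nat assume "i \<le> j"
        then have "?n (min i (2 ^ m)) \<le> ?n (min j (2 ^ m))" by (intro monoD[OF mono_node[OF T]]) auto
        moreover from this have "\<delta> (?n (min j (2 ^ m))) \<le> \<delta> (?n (min i (2 ^ m)))"
          using monotone_onD[OF \<delta>(3)] node_mem[OF T] by (meson min.cobounded2)
        ultimately show "s i \<le> s j"
          unfolding s_def \<sigma>_def by (intro max.mono order_refl diff_mono)
      qed
      have sT: "s (2 ^ m) \<le> T"
        using T \<delta>(1) by (simp add: s_def \<sigma>_def)
      \<comment> \<open>Clamping at \<open>0\<close> is 1-Lipschitz; the node contributes one mesh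
        and the delay at most \<open>K\<close> of them.\<close>
      have inc: "s (Suc i) - s i \<le> (1 + K) * ?h" if i: "i < 2 ^ m" for i
      proof -
        have "\<bar>\<delta> (?n (Suc i)) - \<delta> (?n i)\<bar> \<le> K * ?h"
          using lipschitz_onD[OF \<delta>(2) node_mem[OF T, of "Suc i" m] node_mem[OF T, of i m]] i h nle(3)[of i]
          by (simp add: dist_real_def)
        moreover have "min (Suc i) (2 ^ m) = Suc i" "min i (2 ^ m) = i" using i by auto
        moreover have "max 0 a - max 0 b \<le> \<bar>a - b\<bar>" for a b :: real by linarith
        from this[of "\<sigma> (?n (Suc i))" "\<sigma> (?n i)"]
        have "max 0 (\<sigma> (?n (Suc i))) - max 0 (\<sigma> (?n i)) \<le> \<bar>?n (Suc i) - ?n i\<bar> + \<bar>\<delta> (?n (Suc i)) - \<delta> (?n i)\<bar>"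
          unfolding \<sigma>_def by linarith
        ultimately show ?thesis
          using nle(3)[of i] h by (simp add: s_def distrib_right)
      qed
      have ediff: "e b - e a = (LINT t|lebesgue_on {a..b}. vs m t - v t)" if "0 \<le> a" "a \<le> b" "b \<le> T" for a b
      proof -
        have L: "L2_between a b (vs m)" "L2_between a b v"
          using L2(5)[of m] L2(6) that by (auto simp: L2_on_iff_L2_between intro: L2_between_subinterval)
        have "e b - e a = (xhat m b - xhat m a) - (xbar b - xbar a)" by (simp add: e_def)
        also have "\<dots> = (LINT t|lebesgue_on {a..b}. vs m t) - (LINT t|lebesgue_on {a..b}. v t)"
          unfolding W12_increment[OF vs that] W12_increment[OF v that] ..
        also have "\<dots> = (LINT t|lebesgue_on {a..b}. vs m t - v t)"
          using L2_between_integrable[OF L(1)] L2_between_integrable[OF L(2)] by simp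
        finally show ?thesis .
      qed
      have es: "e (\<sigma> (?n i)) = e (s i)" if "i \<le> 2 ^ m" for i
        using past[OF node_mem[OF T that], of m] init[of m] that
        by (cases "\<sigma> (?n i) \<le> 0") (simp_all add: s_def e_def \<sigma>_def)
      have "(\<Sum>i<2 ^ m. (norm (e (s (Suc i)) - e (s i)))\<^sup>2) \<le> ((1 + K) * ?h) * V m"
        unfolding V_def
      proof (rule sum_sq_increments_le[OF \<open>mono s\<close> _ sT inc _ ediff])
        show "L2_on T (\<lambda>t. vs m t - v t)"
          using L2(5)[of m] L2(6) by (simp add: L2_on_iff_L2_between L2_between_diff)
      qed (use h K in \<open>auto simp: s_def\<close>)
      \<comment> \<open>The factor \<open>?h\<close> gained from Cauchy-Schwarz cancels the
        \<open>1 / ?h\<close> that the mean decomposition produces in \<open>cell\<close>.\<close>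
      then have R: "(\<Sum>i<2 ^ m. (norm (e (s (Suc i)) - e (s i)))\<^sup>2 / ?h) \<le> (1 + K) * V m"
        using h by (simp add: pos_divide_le_eq mult_ac flip: sum_divide_distrib)
      \<comment> \<open>Mean decomposition with the delayed quotient as the constant and
        \<open>dybar\<close> as the function. The mean of \<open>dybar\<close> is the delayed
        quotient of \<open>xbar\<close>, so the deviation is an increment of \<open>e\<close>
        divided by \<open>?h\<close>.\<close>
      have cell: "cellint m i (\<lambda>t. (norm ((Y m (Suc i) - Y m i) /\<^sub>R ?h - dybar t))\<^sup>2)
        = cellint m i (\<lambda>t. (norm ((LINT s|lebesgue_on {?n i..?n (Suc i)}. dybar s) /\<^sub>R ?h - dybar t))\<^sup>2)
          + (norm (e (s (Suc i)) - e (s i)))\<^sup>2 / ?h" if i: "i < 2 ^ m" for i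
      proof -
        let ?I = "LINT s|lebesgue_on {?n i..?n (Suc i)}. dybar s"
        have I: "xbar (\<sigma> (?n (Suc i))) - xbar (\<sigma> (?n i)) = ?I"
          unfolding \<sigma>_def by (rule W12_increment[OF dy]) (use i n0 nle nT in auto)
        have "Y m (Suc i) - Y m i = xhat m (\<sigma> (?n (Suc i))) - xhat m (\<sigma> (?n i))"
          using y[of i m] y[of "Suc i" m] i by (simp add: Y_def \<sigma>_def)
        also have "\<dots> = ?I + (e (\<sigma> (?n (Suc i))) - e (\<sigma> (?n i)))"
          unfolding I[symmetric] e_def by simp
        also have "\<dots> = ?I + (e (s (Suc i)) - e (s i))"
          using es[of i] es[of "Suc i"] i by simp
        finally have "(Y m (Suc i) - Y m i) /\<^sub>R ?h - ?I /\<^sub>R ?h = (e (s (Suc i)) - e (s i)) /\<^sub>R ?h"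
          unfolding scaleR_diff_right[symmetric] by simp
        then have "?h * (norm ((Y m (Suc i) - Y m i) /\<^sub>R ?h - ?I /\<^sub>R ?h))\<^sup>2 = (norm (e (s (Suc i)) - e (s i)))\<^sup>2 / ?h"
          using h by (simp add: power_mult_distrib power2_eq_square divide_inverse)
        then show ?thesis
          using integral_sq_diff_mean[OF L2_on_cell[OF T i L2(2)] nle(2), of "(Y m (Suc i) - Y m i) /\<^sub>R ?h"]
          unfolding cellint_def nle(3) by simp
      qed
      have "(\<Sum>i<2 ^ m. cellint m i (\<lambda>t. (norm ((Y m (Suc i) - Y m i) /\<^sub>R ?h - dybar t))\<^sup>2))
          = E m + (\<Sum>i<2 ^ m. (norm (e (s (Suc i)) - e (s i)))\<^sup>2 / ?h)"
        unfolding E_def sum.distrib[symmetric] by (intro sum.cong refl cell) simp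
      then show ?thesis using R by simp
    qed
    show ?thesis unfolding P 1 3 using 2 by simp
  qed
  then have "P \<longlonglongrightarrow> 0"
    using nn by (intro tendsto_sandwich[OF _ _ tendsto_const lim]) auto
  then show ?thesis unfolding P_def .
qed

section \<open>Feasibility of the nodal values, and the conclusion\<close>

theorem proposition4p3:
  fixes T \<Delta> \<beta> L \<epsilon> :: real
    and s :: nat
    and xstar :: "nat \<Rightarrow> real ^ 'n" and c :: "nat \<Rightarrow> real" and C :: "(real ^ 'n) set"
    and U :: "(real ^ 'd) set"
    and g :: "real \<Rightarrow> real ^ 'n \<Rightarrow> real ^ 'n \<Rightarrow> real ^ 'd \<Rightarrow> real ^ 'n"
    and \<delta> :: "real \<Rightarrow> real"
    and hist :: "real \<Rightarrow> real ^ 'n"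
    and cost :: "real ^ 'n \<Rightarrow> real"
    and xbar dxbar dybar :: "real \<Rightarrow> real ^ 'n" and ubar :: "real \<Rightarrow> real ^ 'd"
    and xhat \<rho> :: "nat \<Rightarrow> real \<Rightarrow> real ^ 'n" and uhat :: "nat \<Rightarrow> real \<Rightarrow> real ^ 'd"
    and r :: "nat \<Rightarrow> real \<Rightarrow> real"
  assumes T_pos: "0 < T"
    and C_def: "C = polyhedral_set xstar c s"
    and xstar_unit: "\<forall>j\<in>{1..s}. norm (xstar j) = 1"
    and H1: "U \<noteq> {}" "compact U"
    and H2_cont: "continuous_on ({0..T} \<times> UNIV) (\<lambda>(t, x, y, u). g t x y u)"
    and H2_lip: "\<forall>B. bounded B \<longrightarrow>
      (\<exists>K. \<forall>u\<in>U. K-lipschitz_on ({0..T} \<times> B) (\<lambda>(t, x, y). g t x y u))"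
    and H3: "0 < \<beta>"
      "\<forall>t\<in>{0..T}. \<forall>x y. \<forall>u\<in>U. norm (g t x y u) \<le> \<beta> * (1 + norm x + norm y)"
    and H4: "\<forall>t\<in>{0..T}. 0 \<le> \<delta> t" "\<exists>K. K-lipschitz_on {0..T} \<delta>" "antimono_on {0..T} \<delta>"
      "\<Delta> = (SUP t\<in>{0..T}. \<delta> t)" "0 < \<Delta>"
    and H5: "\<exists>K. K-lipschitz_on {-\<Delta>..0} hist"
    and minimizer: "relaxed_local_minimizer T C U g \<delta> \<Delta> hist cost \<epsilon> xbar ubar"
    and approx: "strong_discrete_approx T C U g \<delta> \<Delta> hist xbar ubar xhat uhat r \<rho>"
    and L: "L-lipschitz_on {0..T} xbar"
    and dxbar: "has_W12_deriv T xbar dxbar"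
    and dybar: "has_W12_deriv T (\<lambda>t. xbar (t - \<delta> t)) dybar"
    and lsc: "lower_semicontinuous cost"
  shows "\<forall>\<^sub>F m in sequentially. \<exists>x u.
    discrete_optimal T C U g \<delta> hist cost L \<epsilon> xbar dxbar dybar ubar r \<rho> m x u"
proof -
  have u: "\<And>m t. t \<in> {0..T} \<Longrightarrow> uhat m t \<in> U" "L2_tendsto T uhat ubar"
    and const: "\<And>m. cellwise_constant T m (r m)" "\<And>m. cellwise_constant T m (\<rho> m)"
      "\<And>m. cellwise_constant T m (uhat m)"
    and xhat: "\<And>m. continuous_on {0..T} (xhat m)" "\<And>m. cellwise_affine T m (xhat m)"
    and past: "\<And>m t. t \<in> {-\<Delta>..0} \<Longrightarrow> xhat m t = hist t"
    and W12: "W12_tendsto T xhat xbar"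
    and nodes: "\<And>m i. i \<in> {1..2 ^ m} \<Longrightarrow> xhat m (node T m i) = xbar (node T m i) \<and> xbar (node T m i) \<in> C"
    and init: "\<And>m. xhat m 0 = hist 0"
    and lip: "\<And>m. L-lipschitz_on {0..T} (xhat m)"
    and incl: "\<And>m i t. i < 2 ^ m \<Longrightarrow> t \<in> {node T m i<..<node T m (Suc i)} \<Longrightarrow>
        vector_derivative (xhat m) (at t) \<in>
          {g (node T m i) (xhat m (node T m i)) (xhat m (node T m i - \<delta> (node T m i))) (uhat m t)
             + r m t *\<^sub>R \<rho> m t - w | w. w \<in> normal_cone C (xhat m (node T m i))}"
    using approx L unfolding strong_discrete_approx_def by blast+
  have hist: "\<And>t. t \<in> {-\<Delta>..0} \<Longrightarrow> xbar t = hist t" and \<epsilon>: "0 < \<epsilon>"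
    using minimizer unfolding relaxed_local_minimizer_def DMP_feasible_def by blast+
  have init': "xbar 0 = hist 0" using hist[of 0] H4(5) by simp
  \<comment> \<open>The supremum is an upper bound only for a set bounded above, which the Lipschitz
    continuity of \<open>\<delta>\<close> provides through compactness.\<close>
  have \<delta>_le: "\<delta> t \<le> \<Delta>" if "t \<in> {0..T}" for t
  proof -
    obtain K where "K-lipschitz_on {0..T} \<delta>" using H4(2) by blast
    then have "compact (\<delta> ` {0..T})"
      by (intro compact_continuous_image lipschitz_on_continuous_on) auto
    then show ?thesis
      unfolding H4(4) using that by (intro cSUP_upper bounded_imp_bdd_above compact_imp_bounded)
  qed
  \<comment> \<open>The approximation gives agreement from index \<open>1\<close> on; at index
    \<open>0\<close> both trajectories start at \<open>hist 0\<close>.\<close>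
  have node_eq: "xhat m (node T m i) = xbar (node T m i)" if "i \<le> 2 ^ m" for m i
    using nodes[of i m] that init init' by (cases "i = 0") auto
  have y: "delayed_state T \<delta> hist m (\<lambda>i. xbar (node T m i)) i = xhat m (node T m i - \<delta> (node T m i))"
    if i: "i \<le> 2 ^ m" for m i
  proof -
    let ?t = "node T m i - \<delta> (node T m i)"
    have n: "node T m i \<in> {0..T}" by (rule node_mem[OF T_pos i])
    have t: "-\<Delta> \<le> ?t" "?t \<le> T" using \<delta>_le[OF n] H4(1) n by fastforce+
    show ?thesis
    proof (cases "?t \<le> 0")
      case True
      then show ?thesis using past[of ?t m] t by (simp add: delayed_state_def interpolant_def)
    next
      case False
      then show ?thesis
        unfolding delayed_state_def using t node_eq
        by (intro interpolant_nodes[OF T_pos xhat(2,1)]) auto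
    qed
  qed
  have past_eq: "xhat m (t - \<delta> t) = xbar (t - \<delta> t)" if "t \<in> {0..T}" "t - \<delta> t \<le> 0" for m t
    using past[of "t - \<delta> t" m] hist[of "t - \<delta> t"] \<delta>_le[of t] that by simp
  obtain K where K: "K-lipschitz_on {0..T} \<delta>" using H4(2) by blast
  have L2: "L2_on T dxbar" "L2_on T dybar" "L2_on T ubar"
    using dxbar dybar u(2) unfolding has_W12_deriv_def L2_tendsto_def by blast+
  have "(\<lambda>m. penalty T \<delta> hist dxbar dybar ubar m (\<lambda>i. xbar (node T m i)) (\<lambda>i. uhat m (node T m i))) \<longlonglongrightarrow> 0"
    by (rule penalty_nodes_tendsto[OF T_pos H4(1) K H4(3) dxbar dybar W12 u(2) const(3) y past_eq])
      (simp_all add: init init')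
  then have "\<forall>\<^sub>F m in sequentially. penalty T \<delta> hist dxbar dybar ubar m
      (\<lambda>i. xbar (node T m i)) (\<lambda>i. uhat m (node T m i)) < \<epsilon> / 2"
    using \<epsilon> by (intro order_tendstoD(2)) auto
  moreover have "\<forall>\<^sub>F m in sequentially. 2 * L * mesh T m < \<epsilon> / 2"
    using tendsto_mult_right_zero[OF mesh_tendsto_0, of "2 * L" T] \<epsilon> by (intro order_tendstoD(2)) auto
  ultimately show ?thesis
  proof eventually_elim
    case (elim m)
    let ?n = "node T m" and ?h = "mesh T m"
    have h: "0 < ?h" by (rule mesh_pos[OF T_pos])
    have step: "\<exists>w. xbar (?n (Suc i)) - xbar (?n i) =
        - ?h *\<^sub>R (w - g (?n i) (xbar (?n i)) (xhat m (?n i - \<delta> (?n i))) (uhat m (?n i)) - r m (?n i) *\<^sub>R \<rho> m (?n i))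
        \<and> w \<in> normal_cone C (xbar (?n i))"
      if i: "i < 2 ^ m" for i
    proof -
      \<comment> \<open>The differential inclusion holds only inside the open cell. Any interior
        point serves: \<open>r m\<close>, \<open>\<rho> m\<close> and \<open>uhat m\<close> have the
        same values there as at the left node, and the derivative is the difference
        quotient.\<close>
      define t where "t = ?n i + ?h / 2"
      have t: "t \<in> {?n i<..<?n (Suc i)}" "t \<in> {?n i..<?n (Suc i)}" "?n i \<in> {?n i..<?n (Suc i)}"
        using h by (simp_all add: t_def node_Suc)
      have "r m t = r m (?n i)" "\<rho> m t = \<rho> m (?n i)" "uhat m t = uhat m (?n i)"
        using const[of m] i t(2,3) unfolding cellwise_constant_def by metis+
      then obtain w where w: "w \<in> normal_cone C (xbar (?n i))"
        "vector_derivative (xhat m) (at t) = g (?n i) (xbar (?n i)) (xhat m (?n i - \<delta> (?n i))) (uhat m (?n i))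
          + r m (?n i) *\<^sub>R \<rho> m (?n i) - w"
        using incl[OF i t(1)] node_eq[of i m] i by auto
      have "xbar (?n (Suc i)) - xbar (?n i) = ?h *\<^sub>R vector_derivative (xhat m) (at t)"
        using cellwise_affine_vector_derivative[OF T_pos xhat(2,1) i t(1)] node_eq[of i m] node_eq[of "Suc i" m] i h
        by simp
      then show ?thesis using w by (intro exI[of _ w]) (simp add: algebra_simps)
    qed
    \<comment> \<open>Membership in \<open>C\<close> is given only at nodes of index at least
      \<open>1\<close>. At the initial node it follows from the inclusion, since
      \<open>normal_cone\<close> is empty off \<open>C\<close>.\<close>
    have mem0: "hist 0 \<in> C"
      using step[of 0] init' by (auto simp: normal_cone_def split: if_splits)
    have memT: "xbar T \<in> C"
      using nodes[of "2 ^ m" m] by simp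
    have speed: "norm ((xbar (?n (Suc i)) - xbar (?n i)) /\<^sub>R ?h) \<le> L" if i: "i < 2 ^ m" for i
    proof -
      have "norm (xbar (?n (Suc i)) - xbar (?n i)) \<le> L * ?h"
        using lipschitz_onD[OF L node_mem[OF T_pos, of "Suc i" m] node_mem[OF T_pos, of i m]] i h
        by (simp add: dist_norm node_Suc)
      then show ?thesis using h by (simp add: divide_inverse[symmetric] pos_divide_le_eq mult.commute[of _ "norm _"])
    qed
    have near: "norm (xhat m (?n i - \<delta> (?n i)) - xbar (?n i - \<delta> (?n i))) \<le> \<epsilon> / 2" if i: "i < 2 ^ m" for i
    proof (cases "?n i - \<delta> (?n i) \<le> 0")
      case True
      then show ?thesis using past_eq[OF node_mem[OF T_pos]] i \<epsilon> by simp
    next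
      case False
      then have t: "?n i - \<delta> (?n i) \<in> {0..T}" using H4(1) node_mem[OF T_pos, of i m] i by fastforce
      have "norm (xhat m (?n i - \<delta> (?n i)) - xbar (?n i - \<delta> (?n i))) \<le> 2 * L * ?h"
        by (rule cellwise_lipschitz_dist[OF T_pos lip L node_eq t])
      then show ?thesis using elim(2) by linarith
    qed
    have "discrete_feasible T C U g \<delta> hist L \<epsilon> xbar dxbar dybar ubar r \<rho> m
        (\<lambda>i. xbar (?n i)) (\<lambda>i. uhat m (?n i))"
      unfolding discrete_feasible_def Let_def
      using step mem0 memT speed near \<epsilon> elim(1) u(1)[OF node_mem[OF T_pos]]
      by (auto simp: y init')
    then show ?case
      by (rule discrete_optimal_exists[OF T_pos _ H1(2) H2_cont H4(1) L2 lsc, rotated])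
        (simp add: C_def closed_polyhedral_set)
  qed
qed

end
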